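(* Let $\mathcal C$ be a $\mathbf k$-linear 2-Calabi--Yau triangulated category with a stability condition $\tau$. Let $X$ be a spherical $\tau$-stable object of $\mathcal C$, and assume that $X$ is (up to isomorphism) the unique $\tau$-stable object of its phase. Let $Y$ be any object of $\mathcal C$ such that $\phi^+(Y)-\phi^-(Y)<1$. Assume, furthermore, that $\operatorname{Hom}^0(Y,Y)=\mathbf k$ and that $X$ is not a direct summand of $Y$. Then: (1) If $\phi^-(Y)=\phi(X)$, then $\phi^+(Y)\ge\phi^+(\sigma_X^{-1}(Y))$. (2) If $\phi^+(Y)=\phi(X)$, then $\phi^-(Y)\le\phi^-(\sigma_X(Y))$.
   Context: $\mathbf k$ is a field. Write $\operatorname{Hom}^i(X,Y)=\operatorname{Hom}(X,Y[i])$ and $\operatorname{Hom}^*(X,Y)=\bigoplus_i\operatorname{Hom}^i(X,Y)$, which is assumed finite-dimensional. 2-Calabi--Yau means there are natural isomorphisms $\operatorname{Hom}^i(X,Y)\cong\operatorname{Hom}^{2-i}(Y,X)^\vee$. An object $X$ is spherical if $\operatorname{Hom}^*(X,X)\cong H^*(S^2,\mathbf k)$ as graded $\mathbf k$-algebras. A spherical object $X$ gives an auto-equivalence $\sigma_X$ of $\mathcal C$, the spherical twist, with exact triangles $$\operatorname{Hom}^*(X,Y)\otimes X\to Y\to\sigma_X(Y)\xrightarrow{+1},\qquad \sigma_X^{-1}(Y)\to Y\to X\otimes\operatorname{Hom}^*(Y,X)^\vee\xrightarrow{+1},$$ whose maps $\operatorname{Hom}^*(X,Y)\otimes X\to Y$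 and $Y\to X\otimes \operatorname{Hom}^*(Y,X)^\vee$ are evaluation and coevaluation. Stability conditions are in the sense of Bridgeland; $\phi(X)$ is the phase of a $\tau$-semistable object $X$. For an object $Y$ with Harder--Narasimhan factors $Z_1,\dots,Z_n$ of phases $\phi(Z_1)>\dots>\phi(Z_n)$, put $\phi^+(Y)=\phi(Z_1)$ and $\phi^-(Y)=\phi(Z_n)$. Objects to which $\phi^\pm$ is applied are understood to be nonzero. *)

theory Defs
  imports Complex_Main "HOL-Computational_Algebra.Polynomial"
begin

section \<open>Linear and triangulated categories\<close>

text \<open>
  Objects are the elements of the type \<open>'o\<close>. All morphism spaces are subspaces of one ambient
  vector space \<open>'m\<close> over \<open>'k\<close>, and composition and shift are operations on \<open>'m\<close> of which only the
  values on composable morphisms matter. This is no restriction: for a given small category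
  take for \<open>'m\<close> the direct sum of all morphism spaces, in which distinct ones meet only in zero.

  The shift is an automorphism of the category; \<open>X\<lbrakk>i\<rbrakk>\<close> is its \<open>i\<close>-th power, for any integer \<open>i\<close>,
  on objects, and \<open>shm C f i\<close> on morphisms. \<open>Tri C X Y Z f g h\<close> says that
  X --f--> Y --g--> Z --h--> X[1] is an exact triangle.
\<close>

record ('k, 'o, 'm) tri_cat =
  smul :: "'k \<Rightarrow> 'm \<Rightarrow> 'm"
  Hom :: "'o \<Rightarrow> 'o \<Rightarrow> 'm set"
  idm :: "'o \<Rightarrow> 'm"
  cmp :: "'m \<Rightarrow> 'm \<Rightarrow> 'm"  (infixl "\<odot>\<index>" 70)
  sh :: "'o \<Rightarrow> int \<Rightarrow> 'o"  ("_\<lbrakk>_\<rbrakk>\<index>" [1000, 0] 1000)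
  shm :: "'m \<Rightarrow> int \<Rightarrow> 'm"
  Tri :: "'o \<Rightarrow> 'o \<Rightarrow> 'o \<Rightarrow> 'm \<Rightarrow> 'm \<Rightarrow> 'm \<Rightarrow> bool"

locale k_linear_category =
  fixes C :: "('k::field, 'o, 'm::ab_group_add) tri_cat" (structure)
  assumes vector_space_smul: "vector_space (smul C)"
    and subspace_Hom: "module.subspace (smul C) (Hom C X Y)"
    and idm_in_Hom: "idm C X \<in> Hom C X X"
    and cmp_in_Hom: "\<lbrakk>f \<in> Hom C X Y; g \<in> Hom C Y Z\<rbrakk> \<Longrightarrow> g \<odot> f \<in> Hom C X Z"
    and cmp_assoc: "\<lbrakk>f \<in> Hom C W X; g \<in> Hom C X Y; h \<in> Hom C Y Z\<rbrakk>
      \<Longrightarrow> h \<odot> (g \<odot> f) = (h \<odot> g) \<odot> f"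
    and cmp_idm_left: "f \<in> Hom C X Y \<Longrightarrow> idm C Y \<odot> f = f"
    and cmp_idm_right: "f \<in> Hom C X Y \<Longrightarrow> f \<odot> idm C X = f"
    and cmp_add_left: "\<lbrakk>f \<in> Hom C X Y; g \<in> Hom C Y Z; g' \<in> Hom C Y Z\<rbrakk>
      \<Longrightarrow> (g + g') \<odot> f = g \<odot> f + g' \<odot> f"
    and cmp_add_right: "\<lbrakk>f \<in> Hom C X Y; f' \<in> Hom C X Y; g \<in> Hom C Y Z\<rbrakk>
      \<Longrightarrow> g \<odot> (f + f') = g \<odot> f + g \<odot> f'"
    and cmp_smul_left: "\<lbrakk>f \<in> Hom C X Y; g \<in> Hom C Y Z\<rbrakk>
      \<Longrightarrow> smul C c g \<odot> f = smul C c (g \<odot> f)"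
    and cmp_smul_right: "\<lbrakk>f \<in> Hom C X Y; g \<in> Hom C Y Z\<rbrakk>
      \<Longrightarrow> g \<odot> smul C c f = smul C c (g \<odot> f)"

definition zero_object :: "('k::field, 'o, 'm::ab_group_add) tri_cat \<Rightarrow> 'o \<Rightarrow> bool" where
  "zero_object C X \<longleftrightarrow> (\<forall>A. Hom C A X = {0} \<and> Hom C X A = {0})"

definition is_iso :: "('k::field, 'o, 'm::ab_group_add) tri_cat \<Rightarrow> 'o \<Rightarrow> 'o \<Rightarrow> 'm \<Rightarrow> bool" where
  "is_iso C X Y f \<longleftrightarrow>
    f \<in> Hom C X Y \<and> (\<exists>g\<in>Hom C Y X. cmp C g f = idm C X \<and> cmp C f g = idm C Y)"

definition isomorphic :: "('k::field, 'o, 'm::ab_group_add) tri_cat \<Rightarrow> 'o \<Rightarrow> 'o \<Rightarrow> bool" where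
  "isomorphic C X Y \<longleftrightarrow> (\<exists>f. is_iso C X Y f)"

text \<open>The object \<open>E\<close> is the direct sum of the finite family \<open>F\<close> over \<open>I\<close>, with inclusions \<open>\<iota>\<close> and
  projections \<open>\<pi>\<close>.\<close>

definition biproduct ::
  "('k::field, 'o, 'm::ab_group_add) tri_cat \<Rightarrow> 'i set \<Rightarrow> ('i \<Rightarrow> 'o) \<Rightarrow> 'o \<Rightarrow>
    ('i \<Rightarrow> 'm) \<Rightarrow> ('i \<Rightarrow> 'm) \<Rightarrow> bool" where
  "biproduct C I F E \<iota> \<pi> \<longleftrightarrow>
    finite I \<and>
    (\<forall>i\<in>I. \<iota> i \<in> Hom C (F i) E \<and> \<pi> i \<in> Hom C E (F i)) \<and>
    (\<forall>i\<in>I. \<forall>j\<in>I. cmp C (\<pi> i) (\<iota> j) = (if i = j then idm C (F i) else 0)) \<and>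
    (\<Sum>i\<in>I. cmp C (\<iota> i) (\<pi> i)) = idm C E"

definition direct_sum :: "('k::field, 'o, 'm::ab_group_add) tri_cat \<Rightarrow> 'o \<Rightarrow> 'o \<Rightarrow> 'o \<Rightarrow> bool" where
  "direct_sum C A B E \<longleftrightarrow>
    (\<exists>\<iota> \<pi>. biproduct C (UNIV :: bool set) (\<lambda>b. if b then A else B) E \<iota> \<pi>)"

definition direct_summand :: "('k::field, 'o, 'm::ab_group_add) tri_cat \<Rightarrow> 'o \<Rightarrow> 'o \<Rightarrow> bool" where
  "direct_summand C X Y \<longleftrightarrow> (\<exists>W. direct_sum C X W Y)"

locale triangulated_category = k_linear_category C for C :: "('k::field, 'o, 'm::ab_group_add) tri_cat" (structure) +
  assumes ex_zero: "\<exists>N. zero_object C N"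
    and ex_direct_sum: "\<exists>E. direct_sum C A B E"
    \<comment> \<open>the shift automorphism and its powers\<close>
    and sh_0: "X\<lbrakk>0\<rbrakk> = X"
    and sh_sh: "X\<lbrakk>i\<rbrakk>\<lbrakk>j\<rbrakk> = X\<lbrakk>i + j\<rbrakk>"
    and shm_in_Hom: "f \<in> Hom C X Y \<Longrightarrow> shm C f i \<in> Hom C (X\<lbrakk>i\<rbrakk>) (Y\<lbrakk>i\<rbrakk>)"
    and shm_0: "f \<in> Hom C X Y \<Longrightarrow> shm C f 0 = f"
    and shm_shm: "f \<in> Hom C X Y \<Longrightarrow> shm C (shm C f i) j = shm C f (i + j)"
    and shm_idm: "shm C (idm C X) i = idm C (X\<lbrakk>i\<rbrakk>)"
    and shm_cmp: "\<lbrakk>f \<in> Hom C X Y; g \<in> Hom C Y Z\<rbrakk> \<Longrightarrow> shm C (g \<odot> f) i = shm C g i \<odot> shm C f i"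
    and shm_add: "\<lbrakk>f \<in> Hom C X Y; g \<in> Hom C X Y\<rbrakk> \<Longrightarrow> shm C (f + g) i = shm C f i + shm C g i"
    and shm_smul: "f \<in> Hom C X Y \<Longrightarrow> shm C (smul C r f) i = smul C r (shm C f i)"
    \<comment> \<open>Verdier's axioms TR1 to TR4\<close>
    and Tri_in_Hom: "Tri C X Y Z f g h \<Longrightarrow>
      f \<in> Hom C X Y \<and> g \<in> Hom C Y Z \<and> h \<in> Hom C Z (X\<lbrakk>1\<rbrakk>)"
    and Tri_iso: "\<lbrakk>Tri C X Y Z f g h; is_iso C X X' a; is_iso C Y Y' b; is_iso C Z Z' c;
        f' \<in> Hom C X' Y'; g' \<in> Hom C Y' Z'; h' \<in> Hom C Z' (X'\<lbrakk>1\<rbrakk>);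
        b \<odot> f = f' \<odot> a; c \<odot> g = g' \<odot> b; shm C a 1 \<odot> h = h' \<odot> c\<rbrakk>
      \<Longrightarrow> Tri C X' Y' Z' f' g' h'"
    and Tri_idm: "zero_object C N \<Longrightarrow> Tri C X X N (idm C X) 0 0"
    and ex_cone: "f \<in> Hom C X Y \<Longrightarrow> \<exists>Z g h. Tri C X Y Z f g h"
    and Tri_rotate: "\<lbrakk>f \<in> Hom C X Y; g \<in> Hom C Y Z; h \<in> Hom C Z (X\<lbrakk>1\<rbrakk>)\<rbrakk>
      \<Longrightarrow> Tri C X Y Z f g h \<longleftrightarrow> Tri C Y Z (X\<lbrakk>1\<rbrakk>) g h (- shm C f 1)"
    and Tri_morphism: "\<lbrakk>Tri C X Y Z f g h; Tri C X' Y' Z' f' g' h';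
        a \<in> Hom C X X'; b \<in> Hom C Y Y'; b \<odot> f = f' \<odot> a\<rbrakk>
      \<Longrightarrow> \<exists>c\<in>Hom C Z Z'. c \<odot> g = g' \<odot> b \<and> shm C a 1 \<odot> h = h' \<odot> c"
    and octahedral: "\<lbrakk>Tri C X Y Z' f f1 f2; Tri C Y Z X' g g1 g2; Tri C X Z Y' (g \<odot> f) k1 k2\<rbrakk>
      \<Longrightarrow> \<exists>a b. Tri C Z' Y' X' a b (shm C f1 1 \<odot> g2) \<and>
        a \<odot> f1 = k1 \<odot> g \<and> k2 \<odot> a = f2 \<and> b \<odot> k1 = g1 \<and> g2 \<odot> b = shm C f 1 \<odot> k2"

section \<open>Graded morphism spaces, Calabi--Yau condition, spherical objects\<close>

definition gHom :: "('k::field, 'o, 'm::ab_group_add) tri_cat \<Rightarrow> int \<Rightarrow> 'o \<Rightarrow> 'o \<Rightarrow> 'm set" where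
  "gHom C i X Y = Hom C X (sh C Y i)"

definition hom_finite :: "('k::field, 'o, 'm::ab_group_add) tri_cat \<Rightarrow> bool" where
  "hom_finite C \<longleftrightarrow> (\<forall>X Y.
    finite {i. gHom C i X Y \<noteq> {0}} \<and>
    (\<forall>i. \<exists>B. finite B \<and> gHom C i X Y = module.span (smul C) B))"

text \<open>A linear functional on a subspace \<open>V\<close> is represented by the function that agrees with it
  on \<open>V\<close> and vanishes outside \<open>V\<close>.\<close>

definition dual_space :: "('k::field, 'o, 'm::ab_group_add) tri_cat \<Rightarrow> 'm set \<Rightarrow> ('m \<Rightarrow> 'k) set" where
  "dual_space C V = {u.
    (\<forall>v\<in>V. \<forall>w\<in>V. u (v + w) = u v + u w) \<and>
    (\<forall>c. \<forall>v\<in>V. u (smul C c v) = c * u v) \<and>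
    (\<forall>v. v \<notin> V \<longrightarrow> u v = 0)}"

text \<open>\<open>D i X Y\<close> is an isomorphism of Hom^i(X,Y) with the dual of Hom^(2-i)(Y,X), natural in both
  arguments.\<close>

definition calabi_yau_2 :: "('k::field, 'o, 'm::ab_group_add) tri_cat \<Rightarrow> bool" where
  "calabi_yau_2 C \<longleftrightarrow> (\<exists>D :: int \<Rightarrow> 'o \<Rightarrow> 'o \<Rightarrow> 'm \<Rightarrow> 'm \<Rightarrow> 'k.
    (\<forall>i X Y.
      bij_betw (D i X Y) (gHom C i X Y) (dual_space C (gHom C (2 - i) Y X)) \<and>
      (\<forall>a\<in>gHom C i X Y. \<forall>b\<in>gHom C i X Y. D i X Y (a + b) = (\<lambda>v. D i X Y a v + D i X Y b v)) \<and>
      (\<forall>c. \<forall>a\<in>gHom C i X Y. D i X Y (smul C c a) = (\<lambda>v. c * D i X Y a v))) \<and>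
    (\<forall>i X X' Y. \<forall>f\<in>Hom C X' X. \<forall>a\<in>gHom C i X Y. \<forall>v\<in>gHom C (2 - i) Y X'.
      D i X' Y (cmp C a f) v = D i X Y a (cmp C (shm C f (2 - i)) v)) \<and>
    (\<forall>i X Y Y'. \<forall>g\<in>Hom C Y Y'. \<forall>a\<in>gHom C i X Y. \<forall>v\<in>gHom C (2 - i) Y' X.
      D i X Y' (cmp C (shm C g i) a) v = D i X Y a (cmp C v g)))"

text \<open>The cohomology algebra of the 2-sphere is the graded algebra k[t]/(t^2) with t of degree 2.
  Residue classes are represented by polynomials of degree at most 1.\<close>

definition S2_cohomology :: "int \<Rightarrow> 'k::field poly set" where
  "S2_cohomology i =
    (if i = 0 then range (\<lambda>a. [:a:]) else if i = 2 then range (\<lambda>b. [:0, b:]) else {0})"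

definition S2_cup :: "'k::field poly \<Rightarrow> 'k poly \<Rightarrow> 'k poly" where
  "S2_cup p q = (p * q) mod monom 1 2"

definition spherical :: "('k::field, 'o, 'm::ab_group_add) tri_cat \<Rightarrow> 'o \<Rightarrow> bool" where
  "spherical C X \<longleftrightarrow> (\<exists>\<Theta> :: int \<Rightarrow> 'm \<Rightarrow> 'k poly.
    (\<forall>i. bij_betw (\<Theta> i) (gHom C i X X) (S2_cohomology i) \<and>
      (\<forall>a\<in>gHom C i X X. \<forall>b\<in>gHom C i X X. \<Theta> i (a + b) = \<Theta> i a + \<Theta> i b) \<and>
      (\<forall>c. \<forall>a\<in>gHom C i X X. \<Theta> i (smul C c a) = smult c (\<Theta> i a))) \<and>
    \<Theta> 0 (idm C X) = 1 \<and>
    (\<forall>i j. \<forall>a\<in>gHom C i X X. \<forall>b\<in>gHom C j X X.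
      \<Theta> (i + j) (cmp C (shm C a j) b) = S2_cup (\<Theta> i a) (\<Theta> j b)))"

section \<open>Auto-equivalences and spherical twists\<close>

definition linear_functor ::
  "('k::field, 'o, 'm::ab_group_add) tri_cat \<Rightarrow> ('o \<Rightarrow> 'o) \<Rightarrow> ('m \<Rightarrow> 'm) \<Rightarrow> bool" where
  "linear_functor C Fo Fm \<longleftrightarrow>
    (\<forall>X Y. \<forall>f\<in>Hom C X Y. Fm f \<in> Hom C (Fo X) (Fo Y)) \<and>
    (\<forall>X. Fm (idm C X) = idm C (Fo X)) \<and>
    (\<forall>X Y Z. \<forall>f\<in>Hom C X Y. \<forall>g\<in>Hom C Y Z. Fm (cmp C g f) = cmp C (Fm g) (Fm f)) \<and>
    (\<forall>X Y. \<forall>f\<in>Hom C X Y. \<forall>g\<in>Hom C X Y. Fm (f + g) = Fm f + Fm g) \<and>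
    (\<forall>X Y. \<forall>c. \<forall>f\<in>Hom C X Y. Fm (smul C c f) = smul C c (Fm f))"

definition natural_iso ::
  "('k::field, 'o, 'm::ab_group_add) tri_cat \<Rightarrow> ('o \<Rightarrow> 'o) \<Rightarrow> ('m \<Rightarrow> 'm) \<Rightarrow> ('o \<Rightarrow> 'o) \<Rightarrow>
    ('m \<Rightarrow> 'm) \<Rightarrow> ('o \<Rightarrow> 'm) \<Rightarrow> bool" where
  "natural_iso C Fo Fm Go Gm \<eta> \<longleftrightarrow>
    (\<forall>X. is_iso C (Fo X) (Go X) (\<eta> X)) \<and>
    (\<forall>X Y. \<forall>f\<in>Hom C X Y. cmp C (\<eta> Y) (Fm f) = cmp C (Gm f) (\<eta> X))"

definition exact_functor ::
  "('k::field, 'o, 'm::ab_group_add) tri_cat \<Rightarrow> ('o \<Rightarrow> 'o) \<Rightarrow> ('m \<Rightarrow> 'm) \<Rightarrow> bool" where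
  "exact_functor C Fo Fm \<longleftrightarrow> linear_functor C Fo Fm \<and>
    (\<exists>\<theta>. natural_iso C (\<lambda>X. Fo (sh C X 1)) (\<lambda>f. Fm (shm C f 1))
          (\<lambda>X. sh C (Fo X) 1) (\<lambda>f. shm C (Fm f) 1) \<theta> \<and>
      (\<forall>X Y Z f g h. Tri C X Y Z f g h \<longrightarrow>
        Tri C (Fo X) (Fo Y) (Fo Z) (Fm f) (Fm g) (cmp C (\<theta> X) (Fm h))))"

definition mutually_inverse_autoequivalences ::
  "('k::field, 'o, 'm::ab_group_add) tri_cat \<Rightarrow> ('o \<Rightarrow> 'o) \<Rightarrow> ('m \<Rightarrow> 'm) \<Rightarrow> ('o \<Rightarrow> 'o) \<Rightarrow>
    ('m \<Rightarrow> 'm) \<Rightarrow> bool" where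
  "mutually_inverse_autoequivalences C Fo Fm Go Gm \<longleftrightarrow>
    exact_functor C Fo Fm \<and> exact_functor C Go Gm \<and>
    (\<exists>\<eta>. natural_iso C (\<lambda>X. Go (Fo X)) (\<lambda>f. Gm (Fm f)) (\<lambda>X. X) (\<lambda>f. f) \<eta>) \<and>
    (\<exists>\<epsilon>. natural_iso C (\<lambda>X. Fo (Go X)) (\<lambda>f. Fm (Gm f)) (\<lambda>X. X) (\<lambda>f. f) \<epsilon>)"

text \<open>A finite homogeneous basis of Hom^*(X,Y); the pair \<open>(i, f)\<close> stands for the basis element
  \<open>f\<close> of degree \<open>i\<close>.\<close>

definition homogeneous_basis ::
  "('k::field, 'o, 'm::ab_group_add) tri_cat \<Rightarrow> 'o \<Rightarrow> 'o \<Rightarrow> (int \<times> 'm) set \<Rightarrow> bool" where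
  "homogeneous_basis C X Y B \<longleftrightarrow> finite B \<and>
    (\<forall>i. \<not> module.dependent (smul C) {f. (i, f) \<in> B} \<and>
      module.span (smul C) {f. (i, f) \<in> B} = gHom C i X Y)"

text \<open>For a finite-dimensional graded space V, the object V \<open>\<otimes>\<close> X is the direct sum of copies of
  X[-i], one for each element of degree i of a homogeneous basis of V. Evaluation
  Hom^*(X,Y) \<open>\<otimes>\<close> X \<open>\<rightarrow>\<close> Y is the map whose restriction to the summand X[-i] of a basis element
  \<open>f\<close> : X \<open>\<rightarrow>\<close> Y[i] is \<open>f\<close>[-i].\<close>

definition evaluation ::
  "('k::field, 'o, 'm::ab_group_add) tri_cat \<Rightarrow> 'o \<Rightarrow> 'o \<Rightarrow> 'o \<Rightarrow> 'm \<Rightarrow> bool" where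
  "evaluation C X Y E ev \<longleftrightarrow> ev \<in> Hom C E Y \<and>
    (\<exists>B \<iota> \<pi>. homogeneous_basis C X Y B \<and>
      biproduct C B (\<lambda>(i, f). sh C X (- i)) E \<iota> \<pi> \<and>
      (\<forall>(i, f)\<in>B. cmp C ev (\<iota> (i, f)) = shm C f (- i)))"

text \<open>In the dual of Hom^*(Y,X) the dual basis element of \<open>f\<close> : Y \<open>\<rightarrow>\<close> X[i] has degree -i, so it
  contributes the summand X[i]; the corresponding component of the coevaluation map
  Y \<open>\<rightarrow>\<close> X \<open>\<otimes>\<close> Hom^*(Y,X)^* is \<open>f\<close>.\<close>

definition coevaluation ::
  "('k::field, 'o, 'm::ab_group_add) tri_cat \<Rightarrow> 'o \<Rightarrow> 'o \<Rightarrow> 'o \<Rightarrow> 'm \<Rightarrow> bool" where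
  "coevaluation C X Y E coev \<longleftrightarrow> coev \<in> Hom C Y E \<and>
    (\<exists>B \<iota> \<pi>. homogeneous_basis C Y X B \<and>
      biproduct C B (\<lambda>(i, f). sh C X i) E \<iota> \<pi> \<and>
      (\<forall>(i, f)\<in>B. cmp C (\<pi> (i, f)) coev = f))"

text \<open>\<open>(So, Sm)\<close> is the twist along \<open>X\<close> and \<open>(So', Sm')\<close> is its inverse, each on objects and on
  morphisms.\<close>

definition spherical_twist ::
  "('k::field, 'o, 'm::ab_group_add) tri_cat \<Rightarrow> 'o \<Rightarrow> ('o \<Rightarrow> 'o) \<Rightarrow> ('m \<Rightarrow> 'm) \<Rightarrow> ('o \<Rightarrow> 'o) \<Rightarrow>
    ('m \<Rightarrow> 'm) \<Rightarrow> bool" where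
  "spherical_twist C X So Sm So' Sm' \<longleftrightarrow>
    mutually_inverse_autoequivalences C So Sm So' Sm' \<and>
    (\<forall>Y. \<exists>E ev g h. evaluation C X Y E ev \<and> Tri C E Y (So Y) ev g h) \<and>
    (\<forall>Y. \<exists>E g coev h. coevaluation C X Y E coev \<and> Tri C (So' Y) Y E g coev h)"

section \<open>Stability conditions\<close>

definition HN_filtration ::
  "('k::field, 'o, 'm::ab_group_add) tri_cat \<Rightarrow> (real \<Rightarrow> 'o set) \<Rightarrow> 'o \<Rightarrow> nat \<Rightarrow> (nat \<Rightarrow> 'o) \<Rightarrow>
    (nat \<Rightarrow> 'o) \<Rightarrow> (nat \<Rightarrow> real) \<Rightarrow> bool" where
  "HN_filtration C P Y n E A ph \<longleftrightarrow>
    0 < n \<and> zero_object C (E 0) \<and> E n = Y \<and>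
    (\<forall>j<n. \<not> zero_object C (A j) \<and> A j \<in> P (ph j) \<and>
      (\<exists>f g h. Tri C (E j) (E (Suc j)) (A j) f g h)) \<and>
    (\<forall>j. Suc j < n \<longrightarrow> ph (Suc j) < ph j)"

text \<open>\<open>P t\<close> is the class of objects of the full subcategory of semistable objects of phase \<open>t\<close>
  (together with zero objects), taken to be closed under isomorphism.\<close>

definition slicing ::
  "('k::field, 'o, 'm::ab_group_add) tri_cat \<Rightarrow> (real \<Rightarrow> 'o set) \<Rightarrow> bool" where
  "slicing C P \<longleftrightarrow>
    (\<forall>t X Y. X \<in> P t \<and> isomorphic C X Y \<longrightarrow> Y \<in> P t) \<and>
    (\<forall>t X. zero_object C X \<longrightarrow> X \<in> P t) \<and>
    (\<forall>t A B E. A \<in> P t \<and> B \<in> P t \<and> direct_sum C A B E \<longrightarrow> E \<in> P t) \<and>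
    (\<forall>t X. X \<in> P t \<longleftrightarrow> sh C X 1 \<in> P (t + 1)) \<and>
    (\<forall>s t A B. s > t \<and> A \<in> P s \<and> B \<in> P t \<longrightarrow> Hom C A B = {0}) \<and>
    (\<forall>Y. \<not> zero_object C Y \<longrightarrow> (\<exists>n E A ph. HN_filtration C P Y n E A ph))"

text \<open>A homomorphism from the Grothendieck group to the complex numbers is the same as a function
  on objects that is additive on exact triangles.\<close>

definition central_charge ::
  "('k::field, 'o, 'm::ab_group_add) tri_cat \<Rightarrow> (real \<Rightarrow> 'o set) \<Rightarrow> ('o \<Rightarrow> complex) \<Rightarrow> bool" where
  "central_charge C P Z \<longleftrightarrow>
    (\<forall>A B E f g h. Tri C A E B f g h \<longrightarrow> Z E = Z A + Z B) \<and>
    (\<forall>t X. X \<in> P t \<and> \<not> zero_object C X \<longrightarrow> (\<exists>m>0. Z X = of_real m * cis (pi * t)))"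

text \<open>The extension-closed subcategory P(I) generated by the P(t) with t in I.\<close>

inductive_set P_interval ::
  "('k::field, 'o, 'm::ab_group_add) tri_cat \<Rightarrow> (real \<Rightarrow> 'o set) \<Rightarrow> real set \<Rightarrow> 'o set"
  for C P I where
  base: "\<lbrakk>t \<in> I; X \<in> P t\<rbrakk> \<Longrightarrow> X \<in> P_interval C P I"
| extension: "\<lbrakk>Tri C A E B f g h; A \<in> P_interval C P I; B \<in> P_interval C P I\<rbrakk>
    \<Longrightarrow> E \<in> P_interval C P I"

text \<open>The following notions refer to the full subcategory on the objects in \<open>S\<close>. A strict subobject
  is a kernel.\<close>

definition kernel_in ::
  "('k::field, 'o, 'm::ab_group_add) tri_cat \<Rightarrow> 'o set \<Rightarrow> 'o \<Rightarrow> 'o \<Rightarrow> 'o \<Rightarrow> 'm \<Rightarrow> 'm \<Rightarrow> bool" where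
  "kernel_in C S A E B f g \<longleftrightarrow>
    A \<in> S \<and> E \<in> S \<and> B \<in> S \<and> f \<in> Hom C A E \<and> g \<in> Hom C E B \<and> cmp C g f = 0 \<and>
    (\<forall>T\<in>S. \<forall>t\<in>Hom C T E. cmp C g t = 0 \<longrightarrow> (\<exists>!s. s \<in> Hom C T A \<and> cmp C f s = t))"

definition strict_subobject ::
  "('k::field, 'o, 'm::ab_group_add) tri_cat \<Rightarrow> 'o set \<Rightarrow> 'o \<Rightarrow> 'o \<Rightarrow> 'm \<Rightarrow> bool" where
  "strict_subobject C S A E f \<longleftrightarrow> (\<exists>B g. kernel_in C S A E B f g)"

definition noetherian_object ::
  "('k::field, 'o, 'm::ab_group_add) tri_cat \<Rightarrow> 'o set \<Rightarrow> 'o \<Rightarrow> bool" where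
  "noetherian_object C S E \<longleftrightarrow> (\<forall>A a u.
    (\<forall>n::nat. strict_subobject C S (A n) E (a n) \<and>
      u n \<in> Hom C (A n) (A (Suc n)) \<and> cmp C (a (Suc n)) (u n) = a n) \<longrightarrow>
    (\<exists>N. \<forall>n\<ge>N. is_iso C (A n) (A (Suc n)) (u n)))"

definition artinian_object ::
  "('k::field, 'o, 'm::ab_group_add) tri_cat \<Rightarrow> 'o set \<Rightarrow> 'o \<Rightarrow> bool" where
  "artinian_object C S E \<longleftrightarrow> (\<forall>A a u.
    (\<forall>n::nat. strict_subobject C S (A n) E (a n) \<and>
      u n \<in> Hom C (A (Suc n)) (A n) \<and> cmp C (a n) (u n) = a (Suc n)) \<longrightarrow>
    (\<exists>N. \<forall>n\<ge>N. is_iso C (A (Suc n)) (A n) (u n)))"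

definition finite_length ::
  "('k::field, 'o, 'm::ab_group_add) tri_cat \<Rightarrow> 'o set \<Rightarrow> bool" where
  "finite_length C S \<longleftrightarrow> (\<forall>E\<in>S. noetherian_object C S E \<and> artinian_object C S E)"

text \<open>The bound on \<open>\<eta>\<close> makes the intervals shorter than 1, so that the subcategories are
  quasi-abelian.\<close>

definition locally_finite ::
  "('k::field, 'o, 'm::ab_group_add) tri_cat \<Rightarrow> (real \<Rightarrow> 'o set) \<Rightarrow> bool" where
  "locally_finite C P \<longleftrightarrow>
    (\<exists>\<eta>>0. 2 * \<eta> < 1 \<and> (\<forall>t. finite_length C (P_interval C P {t - \<eta><..<t + \<eta>})))"

text \<open>Local finiteness is part of the notion, as for the points of Bridgeland's space of stability
  conditions; it guarantees Jordan--Hoelder filtrations of semistable objects by stable ones.\<close>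

definition stability_condition ::
  "('k::field, 'o, 'm::ab_group_add) tri_cat \<Rightarrow> (real \<Rightarrow> 'o set) \<Rightarrow> ('o \<Rightarrow> complex) \<Rightarrow> bool" where
  "stability_condition C P Z \<longleftrightarrow> slicing C P \<and> central_charge C P Z \<and> locally_finite C P"

text \<open>Simple objects of the full subcategory on \<open>S\<close>: the only subobjects are zero and the whole
  object.\<close>

definition simple_in ::
  "('k::field, 'o, 'm::ab_group_add) tri_cat \<Rightarrow> 'o set \<Rightarrow> 'o \<Rightarrow> bool" where
  "simple_in C S X \<longleftrightarrow> X \<in> S \<and> \<not> zero_object C X \<and>
    (\<forall>A\<in>S. \<forall>f\<in>Hom C A X.
      (\<forall>T\<in>S. \<forall>s\<in>Hom C T A. \<forall>s'\<in>Hom C T A. cmp C f s = cmp C f s' \<longrightarrow> s = s') \<longrightarrow>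
      zero_object C A \<or> is_iso C A X f)"

definition stable_object ::
  "('k::field, 'o, 'm::ab_group_add) tri_cat \<Rightarrow> (real \<Rightarrow> 'o set) \<Rightarrow> 'o \<Rightarrow> bool" where
  "stable_object C P X \<longleftrightarrow> (\<exists>t. simple_in C (P t) X)"

text \<open>The descriptions below are meaningful for nonzero objects (semistable ones in the case of
  \<open>phase\<close>), since the phase and the Harder--Narasimhan filtration are then unique.\<close>

definition phase :: "(real \<Rightarrow> 'o set) \<Rightarrow> 'o \<Rightarrow> real" where
  "phase P X = (THE t. X \<in> P t)"

definition phi_plus ::
  "('k::field, 'o, 'm::ab_group_add) tri_cat \<Rightarrow> (real \<Rightarrow> 'o set) \<Rightarrow> 'o \<Rightarrow> real" where
  "phi_plus C P Y = (THE t. \<exists>n E A ph. HN_filtration C P Y n E A ph \<and> t = ph 0)"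

definition phi_minus ::
  "('k::field, 'o, 'm::ab_group_add) tri_cat \<Rightarrow> (real \<Rightarrow> 'o set) \<Rightarrow> 'o \<Rightarrow> real" where
  "phi_minus C P Y = (THE t. \<exists>n E A ph. HN_filtration C P Y n E A ph \<and> t = ph (n - 1))"

end

theory Submission
  imports Defs
begin

text \<open>
  Consider part (2), with \<open>t\<close> the phase of \<open>X\<close>. As \<open>X\<close> is the only stable object of phase \<open>t\<close>,
  the first Harder--Narasimhan factor \<open>A\<close> of \<open>Y\<close> has \<open>X\<close> as a subobject in \<open>P t\<close>; let \<open>g\<close> be
  the composite of X \<open>\<rightarrow>\<close> A and A \<open>\<rightarrow>\<close> Y. For phase reasons composition with \<open>g\<close> is injective on
  Hom(Y,X), so a nonzero \<open>f\<close> : Y \<open>\<rightarrow>\<close> X would give a nonzero endomorphism \<open>g f\<close> of \<open>Y\<close>. It is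
  invertible since Hom(Y,Y) = k, and then \<open>X\<close> is a direct summand of \<open>Y\<close>. Hence Hom(Y,X) = 0, and
  by duality Hom^2(X,Y) = 0. Together with the bounds on the phases, only Hom^0(X,Y) and Hom^1(X,Y)
  survive, so the cone of Y \<open>\<rightarrow>\<close> \<open>\<sigma>\<close>(Y) is a sum of copies of X[1] and X, whose phases are at least
  \<open>t\<close>, hence at least that of any factor of \<open>Y\<close>. Part (1) is dual.
\<close>

section \<open>Linear categories\<close>

context k_linear_category
begin

sublocale V: vector_space "smul C"
  by (rule vector_space_smul)

lemma zero_in_Hom [simp]: "0 \<in> Hom C X Y"
  using V.subspace_0[OF subspace_Hom] .

lemma diff_in_Hom: "\<lbrakk>f \<in> Hom C X Y; g \<in> Hom C X Y\<rbrakk> \<Longrightarrow> f - g \<in> Hom C X Y"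
  by (rule V.subspace_diff[OF subspace_Hom])

lemma uminus_in_Hom: "f \<in> Hom C X Y \<Longrightarrow> - f \<in> Hom C X Y"
  by (rule V.subspace_neg[OF subspace_Hom])

lemma smul_in_Hom: "f \<in> Hom C X Y \<Longrightarrow> smul C c f \<in> Hom C X Y"
  by (rule V.subspace_scale[OF subspace_Hom])

lemma cmp_zero_left [simp]:
  assumes "f \<in> Hom C X Y"
  shows "0 \<odot> f = 0"
  using cmp_add_left[OF assms zero_in_Hom zero_in_Hom] by simp

lemma cmp_zero_right [simp]:
  assumes "g \<in> Hom C X Y"
  shows "g \<odot> 0 = 0"
  using cmp_add_right[OF zero_in_Hom zero_in_Hom assms] by simp

lemma cmp_uminus_left:
  assumes "f \<in> Hom C X Y" "g \<in> Hom C Y Z"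
  shows "(- g) \<odot> f = - (g \<odot> f)"
  using cmp_add_left[OF assms uminus_in_Hom[OF assms(2)]] assms
  by (simp add: eq_neg_iff_add_eq_0 add.commute)

lemma cmp_uminus_right:
  assumes "f \<in> Hom C X Y" "g \<in> Hom C Y Z"
  shows "g \<odot> (- f) = - (g \<odot> f)"
  using cmp_add_right[OF assms(1) uminus_in_Hom[OF assms(1)] assms(2)] assms
  by (simp add: eq_neg_iff_add_eq_0 add.commute)

lemma cmp_diff_right:
  assumes "f \<in> Hom C X Y" "f' \<in> Hom C X Y" "g \<in> Hom C Y Z"
  shows "g \<odot> (f - f') = g \<odot> f - g \<odot> f'"
  using cmp_add_right[OF assms(1) uminus_in_Hom[OF assms(2)] assms(3)]
    cmp_uminus_right[OF assms(2,3)] by simp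

lemma cmp_sum_left:
  assumes "f \<in> Hom C X Y" "\<And>i. i \<in> I \<Longrightarrow> g i \<in> Hom C Y Z"
  shows "(\<Sum>i\<in>I. g i) \<odot> f = (\<Sum>i\<in>I. g i \<odot> f)"
  using assms(2)
proof (induction I rule: infinite_finite_induct)
  case (insert i I)
  then show ?case
    using V.subspace_sum[OF subspace_Hom, of I g Y Z]
      cmp_add_left[OF assms(1), of "g i" Z "sum g I"] by simp
qed (use assms(1) in auto)

lemma cmp_sum_right:
  assumes "g \<in> Hom C Y Z" "\<And>i. i \<in> I \<Longrightarrow> f i \<in> Hom C X Y"
  shows "g \<odot> (\<Sum>i\<in>I. f i) = (\<Sum>i\<in>I. g \<odot> f i)"
  using assms(2)
proof (induction I rule: infinite_finite_induct)
  case (insert i I)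
  then show ?case
    using V.subspace_sum[OF subspace_Hom, of I f X Y]
      cmp_add_right[OF _ _ assms(1), of "f i" X "sum f I"] by simp
qed (use assms(1) in auto)

section \<open>Zero objects, isomorphisms and biproducts\<close>

lemma zero_object_iff_idm: "zero_object C N \<longleftrightarrow> idm C N = 0"
proof
  assume "zero_object C N"
  then show "idm C N = 0"
    using idm_in_Hom[of N] by (auto simp: zero_object_def)
next
  assume id0: "idm C N = 0"
  have "f = 0" if "f \<in> Hom C A N" for f A
    using cmp_idm_left[OF that] that by (simp add: id0)
  moreover have "f = 0" if "f \<in> Hom C N A" for f A
    using cmp_idm_right[OF that] that by (simp add: id0)
  ultimately show "zero_object C N"
    by (auto simp: zero_object_def)
qed

lemma Hom_zero_object:
  assumes "zero_object C N"
  shows "Hom C A N = {0}" "Hom C N A = {0}"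
  using assms by (auto simp: zero_object_def)

lemma is_iso_inverse:
  assumes "is_iso C X Y f"
  obtains g where "is_iso C Y X g" "g \<odot> f = idm C X" "f \<odot> g = idm C Y"
  using assms by (auto simp: is_iso_def)

lemma isomorphic_sym: "isomorphic C X Y \<Longrightarrow> isomorphic C Y X"
  by (meson is_iso_inverse isomorphic_def)

lemma zero_object_isomorphic:
  assumes "isomorphic C X Y" "zero_object C X"
  shows "zero_object C Y"
proof -
  obtain f g where "f \<in> Hom C X Y" "g \<in> Hom C Y X" "f \<odot> g = idm C Y"
    using assms(1) by (auto simp: isomorphic_def is_iso_def)
  then show ?thesis
    using Hom_zero_object[OF assms(2)] by (auto simp: zero_object_iff_idm)
qed

lemma iso_cancel_left:
  assumes "is_iso C X Y f" "g \<in> Hom C W X" "f \<odot> g = 0"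
  shows "g = 0"
proof -
  obtain f' where f': "f' \<in> Hom C Y X" "f' \<odot> f = idm C X" "f \<in> Hom C X Y"
    using assms(1) by (auto simp: is_iso_def)
  then have "g = f' \<odot> (f \<odot> g)"
    using assms(2) by (simp add: cmp_assoc[OF assms(2)] cmp_idm_left)
  then show ?thesis
    using f' assms(3) by simp
qed

lemma iso_cancel_right:
  assumes "is_iso C X Y f" "g \<in> Hom C Y Z" "g \<odot> f = 0"
  shows "g = 0"
proof -
  obtain f' where f': "f' \<in> Hom C Y X" "f \<odot> f' = idm C Y" "f \<in> Hom C X Y"
    using assms(1) by (auto simp: is_iso_def)
  then have "g = (g \<odot> f) \<odot> f'"
    using assms(2) by (simp add: cmp_assoc[OF f'(1,3) assms(2), symmetric] cmp_idm_right)
  then show ?thesis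
    using f' assms(3) by simp
qed

text \<open>Writing the identity of \<open>E\<close> as the sum of the
  \<open>\<iota> i \<odot> \<pi> i\<close> splits \<open>t\<close> into terms, each factoring
  through \<open>t \<odot> \<iota> i\<close>, which lies in a zero space.\<close>

lemma Hom_biproduct_left:
  assumes "biproduct C I F E \<iota> \<pi>" "\<And>i. i \<in> I \<Longrightarrow> Hom C (F i) T = {0}"
  shows "Hom C E T = {0}"
proof -
  have "t = 0" if t: "t \<in> Hom C E T" for t
  proof -
    have bp: "\<iota> i \<in> Hom C (F i) E" "\<pi> i \<in> Hom C E (F i)" if "i \<in> I" for i
      using assms(1) that by (auto simp: biproduct_def)
    have "t = t \<odot> (\<Sum>i\<in>I. \<iota> i \<odot> \<pi> i)"
      using assms(1) t by (simp add: biproduct_def cmp_idm_right)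
    also have "\<dots> = (\<Sum>i\<in>I. t \<odot> (\<iota> i \<odot> \<pi> i))"
      by (rule cmp_sum_right[OF t]) (use bp cmp_in_Hom in blast)
    also have "\<dots> = 0"
    proof (rule sum.neutral, rule ballI)
      fix i assume i: "i \<in> I"
      have "t \<odot> \<iota> i = 0"
        using cmp_in_Hom[OF bp(1)[OF i] t] assms(2)[OF i] by auto
      then show "t \<odot> (\<iota> i \<odot> \<pi> i) = 0"
        using cmp_assoc[OF bp(2)[OF i] bp(1)[OF i] t] bp(2)[OF i] by simp
    qed
    finally show ?thesis .
  qed
  then show ?thesis by auto
qed

lemma Hom_biproduct_right:
  assumes "biproduct C I F E \<iota> \<pi>" "\<And>i. i \<in> I \<Longrightarrow> Hom C T (F i) = {0}"
  shows "Hom C T E = {0}"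
proof -
  have "t = 0" if t: "t \<in> Hom C T E" for t
  proof -
    have bp: "\<iota> i \<in> Hom C (F i) E" "\<pi> i \<in> Hom C E (F i)" if "i \<in> I" for i
      using assms(1) that by (auto simp: biproduct_def)
    have "t = (\<Sum>i\<in>I. \<iota> i \<odot> \<pi> i) \<odot> t"
      using assms(1) t by (simp add: biproduct_def cmp_idm_left)
    also have "\<dots> = (\<Sum>i\<in>I. (\<iota> i \<odot> \<pi> i) \<odot> t)"
      by (rule cmp_sum_left[OF t]) (use bp cmp_in_Hom in blast)
    also have "\<dots> = 0"
    proof (rule sum.neutral, rule ballI)
      fix i assume i: "i \<in> I"
      have "\<pi> i \<odot> t = 0"
        using cmp_in_Hom[OF t bp(2)[OF i]] assms(2)[OF i] by auto
      then show "(\<iota> i \<odot> \<pi> i) \<odot> t = 0"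
        using cmp_assoc[OF t bp(2)[OF i] bp(1)[OF i]] bp(1)[OF i] by simp
    qed
    finally show ?thesis .
  qed
  then show ?thesis by auto
qed

end

section \<open>Triangulated categories\<close>

context triangulated_category
begin

lemma shm_zero [simp]: "shm C 0 i = 0"
  using shm_add[of 0 X Y 0 i for X Y] by simp

lemma shm_uminus: "f \<in> Hom C X Y \<Longrightarrow> shm C (- f) i = - shm C f i"
  using shm_add[of f X Y "- f" i] uminus_in_Hom[of f X Y]
  by (simp add: eq_neg_iff_add_eq_0 add.commute)

lemma shm_shift_back:
  assumes "f \<in> Hom C (X\<lbrakk>i\<rbrakk>) (Y\<lbrakk>i\<rbrakk>)"
  shows "shm C f (- i) \<in> Hom C X Y" "shm C (shm C f (- i)) i = f"
  using shm_in_Hom[OF assms, of "- i"] shm_shm[OF assms, of "- i" i] shm_0[OF assms]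
  by (simp_all add: sh_sh sh_0)

lemma shm_eq_0: "f \<in> Hom C X Y \<Longrightarrow> shm C f i = 0 \<Longrightarrow> f = 0"
  using shm_shm[of f X Y i "- i"] by (simp add: shm_0)

lemma Hom_shift: "Hom C (X\<lbrakk>i\<rbrakk>) (Y\<lbrakk>i\<rbrakk>) = {0} \<longleftrightarrow> Hom C X Y = {0}"
proof
  assume *: "Hom C (X\<lbrakk>i\<rbrakk>) (Y\<lbrakk>i\<rbrakk>) = {0}"
  have "f = 0" if "f \<in> Hom C X Y" for f
    using shm_eq_0[OF that, of i] shm_in_Hom[OF that, of i] * by auto
  then show "Hom C X Y = {0}" by auto
next
  assume *: "Hom C X Y = {0}"
  have "f = 0" if "f \<in> Hom C (X\<lbrakk>i\<rbrakk>) (Y\<lbrakk>i\<rbrakk>)" for f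
    using shm_shift_back[OF that] * by simp
  then show "Hom C (X\<lbrakk>i\<rbrakk>) (Y\<lbrakk>i\<rbrakk>) = {0}" by auto
qed

lemma Hom_shift_left: "Hom C (X\<lbrakk>i\<rbrakk>) Y = {0} \<longleftrightarrow> Hom C X (Y\<lbrakk>- i\<rbrakk>) = {0}"
  using Hom_shift[of X i "Y\<lbrakk>- i\<rbrakk>"] by (simp add: sh_sh sh_0)

lemma zero_object_shift: "zero_object C (X\<lbrakk>i\<rbrakk>) \<longleftrightarrow> zero_object C X"
proof -
  have "idm C (X\<lbrakk>i\<rbrakk>) = 0 \<longleftrightarrow> idm C X = 0"
    using shm_idm[of X i] shm_eq_0[OF idm_in_Hom, of X i] shm_zero[of i] by auto
  then show ?thesis by (simp add: zero_object_iff_idm)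
qed

lemma Tri_rotated:
  assumes "Tri C X Y Z f g h"
  shows "Tri C Y Z (X\<lbrakk>1\<rbrakk>) g h (- shm C f 1)"
  using Tri_rotate Tri_in_Hom[OF assms] assms by blast

text \<open>Rotation backwards: the sign on \<open>k\<close> cancels the one that a forward rotation
  introduces.\<close>

lemma Tri_fibre:
  assumes "Tri C Y Z W g h k"
  shows "Tri C (W\<lbrakk>-1\<rbrakk>) Y Z (- shm C k (-1)) g h"
proof -
  have g: "g \<in> Hom C Y Z" and h: "h \<in> Hom C Z W" and k: "k \<in> Hom C W (Y\<lbrakk>1\<rbrakk>)"
    using Tri_in_Hom[OF assms] by auto
  have k': "- shm C k (-1) \<in> Hom C (W\<lbrakk>-1\<rbrakk>) Y"
    using shm_in_Hom[OF k, of "-1"] by (simp add: sh_sh sh_0 uminus_in_Hom)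
  have "shm C (- shm C k (-1)) 1 = - k"
    using shm_uminus[OF shm_in_Hom[OF k], of "-1" 1] shm_shm[OF k, of "-1" 1] shm_0[OF k] by simp
  then show ?thesis
    using Tri_rotate[OF k' g, of h] h assms by (simp add: sh_sh sh_0)
qed

section \<open>Exactness of Hom along a triangle, element by element\<close>

lemma Tri_zero_idm:
  assumes "zero_object C N"
  shows "Tri C N T T 0 (idm C T) 0"
proof -
  have "Tri C T T (N\<lbrakk>1\<rbrakk>) (idm C T) 0 (- shm C 0 1)"
    using Tri_idm[of "N\<lbrakk>1\<rbrakk>" T] assms by (simp add: zero_object_shift)
  then show ?thesis
    using Tri_rotate[OF zero_in_Hom[of N T] idm_in_Hom zero_in_Hom] by simp
qed

text \<open>The triangle X -> X -> 0 maps to the given one by the identity and \<open>f\<close>; the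
  third component shows that \<open>g \<odot> f\<close> factors through a zero object.\<close>

lemma Tri_cmp_zero:
  assumes "Tri C X Y Z f g h"
  shows "g \<odot> f = 0"
proof -
  obtain N where N: "zero_object C N"
    using ex_zero by blast
  have f: "f \<in> Hom C X Y"
    using Tri_in_Hom[OF assms] by simp
  have "f \<odot> idm C X = f \<odot> idm C X" ..
  then obtain c where "c \<in> Hom C N Z" "c \<odot> 0 = g \<odot> f"
    using Tri_morphism[OF Tri_idm[OF N] assms idm_in_Hom f] by blast
  then show ?thesis by simp
qed

text \<open>The axiom \<open>Tri_morphism\<close> supplies only the third component of a morphism of
  triangles. Hence both triangles are rotated until the wanted map is third; it then appears shifted
  by 1.\<close>

lemma Tri_lift:
  assumes "Tri C X Y Z f g h" "t \<in> Hom C T Y" "g \<odot> t = 0"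
  obtains s where "s \<in> Hom C T X" "f \<odot> s = t"
proof -
  obtain N where N: "zero_object C N"
    using ex_zero by blast
  have f: "f \<in> Hom C X Y" and g: "g \<in> Hom C Y Z"
    using Tri_in_Hom[OF assms(1)] by auto
  have "Tri C T N (T\<lbrakk>1\<rbrakk>) 0 0 (- idm C (T\<lbrakk>1\<rbrakk>))"
    using Tri_rotated[OF Tri_idm[OF N, of T]] by (simp add: shm_idm)
  moreover have "0 \<odot> 0 = g \<odot> t"
    using assms(3) cmp_zero_left[OF zero_in_Hom] by simp
  ultimately obtain c where c: "c \<in> Hom C (T\<lbrakk>1\<rbrakk>) (X\<lbrakk>1\<rbrakk>)"
    and eq: "shm C t 1 \<odot> (- idm C (T\<lbrakk>1\<rbrakk>)) = (- shm C f 1) \<odot> c"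
    using Tri_morphism[OF _ Tri_rotated[OF assms(1)] assms(2) zero_in_Hom] by blast
  have s: "shm C c (-1) \<in> Hom C T X" "shm C (shm C c (-1)) 1 = c"
    using shm_shift_back[of c T 1 X] c by auto
  \<comment> \<open>Both rotations introduced a minus sign, and the two cancel.\<close>
  have "shm C t 1 = shm C f 1 \<odot> c"
    using eq shm_in_Hom[OF assms(2), of 1] shm_in_Hom[OF f, of 1] c
    by (simp add: cmp_uminus_left cmp_uminus_right[OF idm_in_Hom] cmp_idm_right)
  also have "\<dots> = shm C (f \<odot> shm C c (-1)) 1"
    using shm_cmp[OF s(1) f, of 1] s(2) by simp
  finally have "shm C (shm C t 1) (-1) = shm C (shm C (f \<odot> shm C c (-1)) 1) (-1)"
    by simp
  then have "f \<odot> shm C c (-1) = t"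
    using shm_shm[OF assms(2), of 1 "-1"] shm_shm[OF cmp_in_Hom[OF s(1) f], of 1 "-1"]
      shm_0[OF assms(2)] shm_0[OF cmp_in_Hom[OF s(1) f]] by simp
  then show thesis
    using that s(1) by blast
qed

text \<open>Here the wanted map is already third, in a morphism to the triangle 0 -> T -> T.\<close>

lemma Tri_extend:
  assumes "Tri C X Y Z f g h" "t \<in> Hom C Y T" "t \<odot> f = 0"
  obtains s where "s \<in> Hom C Z T" "s \<odot> g = t"
proof -
  obtain N where N: "zero_object C N"
    using ex_zero by blast
  have "t \<odot> f = 0 \<odot> 0"
    using assms(3) cmp_zero_left[OF zero_in_Hom] by simp
  then obtain c where "c \<in> Hom C Z T" "c \<odot> g = idm C T \<odot> t"
    using Tri_morphism[OF assms(1) Tri_zero_idm[OF N] zero_in_Hom assms(2)] by blast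
  then show thesis
    using that assms(2) by (simp add: cmp_idm_left)
qed

text \<open>The shift t[1] is killed by f[1], so it factors through \<open>h\<close> by a map T[1]
  -> Z, which must vanish.\<close>

lemma Tri_cancel_left:
  assumes "Tri C X Y Z f g h" "t \<in> Hom C T X" "f \<odot> t = 0" "Hom C (T\<lbrakk>1\<rbrakk>) Z = {0}"
  shows "t = 0"
proof -
  have f: "f \<in> Hom C X Y"
    using Tri_in_Hom[OF assms(1)] by simp
  have t1: "shm C t 1 \<in> Hom C (T\<lbrakk>1\<rbrakk>) (X\<lbrakk>1\<rbrakk>)"
    by (rule shm_in_Hom[OF assms(2)])
  have "(- shm C f 1) \<odot> shm C t 1 = 0"
    using shm_cmp[OF assms(2) f, of 1] assms(3) cmp_uminus_left[OF t1 shm_in_Hom[OF f]] by simp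
  then obtain s where "s \<in> Hom C (T\<lbrakk>1\<rbrakk>) Z" "h \<odot> s = shm C t 1"
    using Tri_lift[OF Tri_rotated[OF Tri_rotated[OF assms(1)]] t1] by blast
  moreover have "h \<in> Hom C Z (X\<lbrakk>1\<rbrakk>)"
    using Tri_in_Hom[OF assms(1)] by simp
  ultimately have "shm C t 1 = 0"
    using assms(4) by simp
  then show ?thesis
    using shm_eq_0[OF assms(2)] by simp
qed

lemma Tri_cancel_right:
  assumes "Tri C X Y Z f g h" "t \<in> Hom C Z T" "t \<odot> g = 0" "Hom C (X\<lbrakk>1\<rbrakk>) T = {0}"
  shows "t = 0"
proof -
  have h: "h \<in> Hom C Z (X\<lbrakk>1\<rbrakk>)"
    using Tri_in_Hom[OF assms(1)] by simp
  obtain s where "s \<in> Hom C (X\<lbrakk>1\<rbrakk>) T" "s \<odot> h = t"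
    using Tri_extend[OF Tri_rotated[OF assms(1)] assms(2,3)] by blast
  then show ?thesis
    using assms(4) h by simp
qed

lemma Hom_extension_right:
  assumes "Tri C X Y Z f g h" "Hom C T X = {0}" "Hom C T Z = {0}"
  shows "Hom C T Y = {0}"
proof -
  have "t = 0" if t: "t \<in> Hom C T Y" for t
  proof -
    have "g \<odot> t = 0"
      using Tri_in_Hom[OF assms(1)] cmp_in_Hom[OF t, of g Z] assms(3) by blast
    then obtain s where "s \<in> Hom C T X" "f \<odot> s = t"
      using Tri_lift[OF assms(1) t] by blast
    then have "t = f \<odot> 0"
      using assms(2) by simp
    then show ?thesis
      using cmp_zero_right Tri_in_Hom[OF assms(1)] by blast
  qed
  then show ?thesis by auto
qed

lemma Hom_extension_left:
  assumes "Tri C X Y Z f g h" "Hom C X T = {0}" "Hom C Z T = {0}"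
  shows "Hom C Y T = {0}"
proof -
  have "t = 0" if t: "t \<in> Hom C Y T" for t
  proof -
    have "t \<odot> f = 0"
      using Tri_in_Hom[OF assms(1)] cmp_in_Hom[OF _ t, of f X] assms(2) by blast
    then obtain s where "s \<in> Hom C Z T" "s \<odot> g = t"
      using Tri_extend[OF assms(1) t] by blast
    then have "t = 0 \<odot> g"
      using assms(3) by simp
    then show ?thesis
      using cmp_zero_left Tri_in_Hom[OF assms(1)] by blast
  qed
  then show ?thesis by auto
qed

text \<open>The identity of \<open>Y\<close> lifts to a right inverse \<open>s\<close> of
  \<open>f\<close>. Since \<open>f\<close> annihilates \<open>s \<odot> f - idm C X\<close> and is
  left cancellable, \<open>s\<close> is also a left inverse.\<close>

lemma Tri_is_iso:
  assumes "Tri C X Y Z f g h" "zero_object C Z"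
  shows "is_iso C X Y f"
proof -
  have f: "f \<in> Hom C X Y" and g: "g = 0"
    using Tri_in_Hom[OF assms(1)] Hom_zero_object[OF assms(2)] by auto
  obtain s where s: "s \<in> Hom C Y X" "f \<odot> s = idm C Y"
    using Tri_lift[OF assms(1) idm_in_Hom] cmp_zero_left[OF idm_in_Hom] g by metis
  have sf: "s \<odot> f - idm C X \<in> Hom C X X"
    by (intro diff_in_Hom cmp_in_Hom[OF f s(1)] idm_in_Hom)
  have "f \<odot> (s \<odot> f - idm C X) = 0"
    using cmp_diff_right[OF cmp_in_Hom[OF f s(1)] idm_in_Hom f] cmp_assoc[OF f s(1) f] s(2) f
    by (simp add: cmp_idm_left cmp_idm_right)
  then have "s \<odot> f - idm C X = 0"
    using Tri_cancel_left[OF assms(1) sf] Hom_zero_object[OF assms(2)] by simp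
  then show ?thesis
    using f s by (auto simp: is_iso_def)
qed

lemma is_iso_shift:
  assumes "is_iso C X Y f"
  shows "is_iso C (X\<lbrakk>i\<rbrakk>) (Y\<lbrakk>i\<rbrakk>) (shm C f i)"
proof -
  obtain g where g: "f \<in> Hom C X Y" "g \<in> Hom C Y X" "g \<odot> f = idm C X" "f \<odot> g = idm C Y"
    using assms by (auto simp: is_iso_def)
  then have "shm C g i \<odot> shm C f i = idm C (X\<lbrakk>i\<rbrakk>)" "shm C f i \<odot> shm C g i = idm C (Y\<lbrakk>i\<rbrakk>)"
    by (simp_all flip: shm_cmp shm_idm)
  then show ?thesis
    using g by (auto simp: is_iso_def intro!: shm_in_Hom)
qed

text \<open>Cancelling the isomorphism makes both \<open>g\<close> and \<open>h\<close> zero. As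
  \<open>h\<close> is zero, the identity of \<open>Z\<close> factors through \<open>g\<close>, hence
  is zero.\<close>

lemma zero_object_cone_iso:
  assumes "Tri C X Y Z f g h" "is_iso C X Y f"
  shows "zero_object C Z"
proof -
  have hom: "f \<in> Hom C X Y" "g \<in> Hom C Y Z" "h \<in> Hom C Z (X\<lbrakk>1\<rbrakk>)"
    using Tri_in_Hom[OF assms(1)] by auto
  have "g = 0"
    using iso_cancel_right[OF assms(2) hom(2) Tri_cmp_zero[OF assms(1)]] .
  have "(- shm C f 1) \<odot> h = 0"
    by (rule Tri_cmp_zero[OF Tri_rotated[OF Tri_rotated[OF assms(1)]]])
  then have "shm C f 1 \<odot> h = 0"
    using cmp_uminus_left[OF hom(3) shm_in_Hom[OF hom(1)]] by simp
  then have "h = 0"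
    using iso_cancel_left[OF is_iso_shift[OF assms(2)] hom(3)] by simp
  then obtain s where "s \<in> Hom C Z Y" "g \<odot> s = idm C Z"
    using Tri_lift[OF Tri_rotated[OF assms(1)] idm_in_Hom] cmp_zero_left[OF idm_in_Hom] by metis
  then show ?thesis
    using \<open>g = 0\<close> by (simp add: zero_object_iff_idm)
qed

lemma Tri_iso_third:
  assumes "Tri C X Y Z f g h" "zero_object C X"
  shows "isomorphic C Y Z"
  using Tri_is_iso[OF Tri_rotated[OF assms(1)]] assms(2)
  by (auto simp: isomorphic_def zero_object_shift)

text \<open>The analogue of: if \<open>N\<close> is the kernel of \<open>p\<close> and \<open>M\<close> that of \<open>g\<close>, then the kernel
  \<open>N'\<close> of \<open>g \<odot> p\<close> contains \<open>N\<close> with quotient \<open>M\<close>. The last triangle is shifted by 1 to avoid signs.\<close>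

lemma Tri_kernel_cmp:
  assumes "Tri C N A D a p r" "Tri C M D K m g k"
  obtains N' a' r' u v w where "Tri C N' A K a' (g \<odot> p) r'" "u \<in> Hom C N N'" "a' \<odot> u = a"
    "Tri C (N\<lbrakk>1\<rbrakk>) (N'\<lbrakk>1\<rbrakk>) (M\<lbrakk>1\<rbrakk>) (shm C u 1) v w"
proof -
  have a: "a \<in> Hom C N A" and p: "p \<in> Hom C A D" and g: "g \<in> Hom C D K"
    using Tri_in_Hom[OF assms(1)] Tri_in_Hom[OF assms(2)] by auto
  obtain W k1 k2 where W: "Tri C A K W (g \<odot> p) k1 k2"
    using ex_cone[OF cmp_in_Hom[OF p g]] by blast
  \<comment> \<open>In the rotated triangles the third vertices are N[1] and M[1], so the octahedron
    places the cone \<open>W\<close> of \<open>g \<odot> p\<close> between them. The kernel sought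
    is W[-1].\<close>
  obtain a0 b0 where tri: "Tri C (N\<lbrakk>1\<rbrakk>) W (M\<lbrakk>1\<rbrakk>) a0 b0 (shm C r 1 \<odot> (- shm C m 1))"
    and eq: "k2 \<odot> a0 = - shm C a 1"
    using octahedral[OF Tri_rotated[OF assms(1)] Tri_rotated[OF assms(2)] W] by blast
  have a0: "a0 \<in> Hom C (N\<lbrakk>1\<rbrakk>) W" and k2: "k2 \<in> Hom C W (A\<lbrakk>1\<rbrakk>)"
    using Tri_in_Hom[OF tri] Tri_in_Hom[OF W] by auto
  have W1: "W\<lbrakk>- 1\<rbrakk>\<lbrakk>1\<rbrakk> = W"
    by (simp add: sh_sh sh_0)
  have u: "shm C a0 (-1) \<in> Hom C N (W\<lbrakk>- 1\<rbrakk>)"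
    using shm_in_Hom[OF a0, of "-1"] by (simp add: sh_sh sh_0)
  have u1: "shm C (shm C a0 (-1)) 1 = a0"
    using shm_shm[OF a0] shm_0[OF a0] by simp
  have k2': "shm C k2 (-1) \<in> Hom C (W\<lbrakk>- 1\<rbrakk>) A"
    using shm_in_Hom[OF k2, of "-1"] by (simp add: sh_sh sh_0)
  have "(- shm C k2 (-1)) \<odot> shm C a0 (-1) = - shm C (k2 \<odot> a0) (-1)"
    using cmp_uminus_left[OF u k2'] shm_cmp[OF a0 k2] by simp
  also have "\<dots> = a"
    using eq shm_uminus[OF shm_in_Hom[OF a]] shm_shm[OF a] shm_0[OF a] by simp
  finally have "(- shm C k2 (-1)) \<odot> shm C a0 (-1) = a" .
  then show thesis
    using that[OF Tri_fibre[OF W] u] tri u1 W1 by simp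
qed

section \<open>Scalar endomorphisms, duality, and nonvanishing of twisted objects\<close>

lemma direct_summand_of_nonzero_cmp:
  assumes X: "\<And>a. a \<in> Hom C X X \<Longrightarrow> \<exists>c. a = smul C c (idm C X)"
    and Y: "\<And>a. a \<in> Hom C Y Y \<Longrightarrow> \<exists>c. a = smul C c (idm C Y)"
    and f: "f \<in> Hom C Y X" and g: "g \<in> Hom C X Y" and gf: "g \<odot> f \<noteq> 0"
  shows "direct_summand C X Y"
proof -
  obtain c where c: "g \<odot> f = smul C c (idm C Y)"
    using Y cmp_in_Hom[OF f g] by blast
  then have "c \<noteq> 0"
    using gf by auto
  define f' where "f' = smul C (inverse c) f"
  have f': "f' \<in> Hom C Y X"
    unfolding f'_def by (rule smul_in_Hom[OF f])
  have gf': "g \<odot> f' = idm C Y"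
    using cmp_smul_right[OF f g] c \<open>c \<noteq> 0\<close> by (simp add: f'_def)
  obtain d where d: "f' \<odot> g = smul C d (idm C X)"
    using X cmp_in_Hom[OF g f'] by blast
  \<comment> \<open>Evaluating \<open>g \<odot> f' \<odot> g\<close> in two ways gives both
    \<open>smul C d g\<close> and \<open>g\<close>; as \<open>g\<close> is nonzero, \<open>d\<close>
    is 1.\<close>
  have "smul C d g = g \<odot> (f' \<odot> g)"
    using cmp_smul_right[OF idm_in_Hom g] g by (simp add: d cmp_idm_right)
  also have "\<dots> = g"
    using cmp_assoc[OF g f' g] g by (simp add: gf' cmp_idm_left)
  finally have "smul C (d - 1) g = 0"
    by (simp add: V.scale_left_diff_distrib)
  moreover have "g \<noteq> 0"
    using gf cmp_zero_left[OF f] by blast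
  ultimately have f'g: "f' \<odot> g = idm C X"
    using d by simp
  obtain N where N: "zero_object C N"
    using ex_zero by blast
  have zz: "(0::'m) \<odot> 0 = 0"
    by (rule cmp_zero_left[OF zero_in_Hom])
  \<comment> \<open>Since \<open>g\<close> and \<open>f'\<close> are mutually inverse, the
    complementary summand is a zero object.\<close>
  have "biproduct C UNIV (\<lambda>b. if b then X else N) Y (\<lambda>b. if b then g else 0) (\<lambda>b. if b then f' else 0)"
    using f' g N gf' f'g cmp_zero_left[OF g] cmp_zero_right[OF f'] zz
    by (simp add: biproduct_def UNIV_bool zero_object_iff_idm)
  then show ?thesis
    unfolding direct_summand_def direct_sum_def by blast
qed

text \<open>Duality embeds Hom^i(X,Y) into the dual of the zero space, which has a single
  element.\<close>

lemma CY_vanishing: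
  assumes "calabi_yau_2 C" "gHom C (2 - i) Y X = {0}"
  shows "gHom C i X Y = {0}"
proof -
  obtain D :: "int \<Rightarrow> 'o \<Rightarrow> 'o \<Rightarrow> 'm \<Rightarrow> 'm \<Rightarrow> 'k"
    where "\<forall>i X Y. bij_betw (D i X Y) (gHom C i X Y) (dual_space C (gHom C (2 - i) Y X))"
    using assms(1) unfolding calabi_yau_2_def all_conj_distrib
    by (elim exE conjE) (rule that, assumption)
  then have D: "bij_betw (D i X Y) (gHom C i X Y) (dual_space C {0})"
    using assms(2) by metis
  \<comment> \<open>Functionals are represented by functions vanishing outside the subspace, so on
    \<open>{0}\<close> the zero function is the only one.\<close>
  have u: "u = (\<lambda>_. 0)" if "u \<in> dual_space C {0::'m}" for u
  proof
    fix v
    have "u (smul C 0 0) = 0 * u 0"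
      using that unfolding dual_space_def by blast
    then have "u 0 = 0"
      by simp
    then show "u v = 0"
      using that unfolding dual_space_def by (cases "v = 0") auto
  qed
  have "f = 0" if f: "f \<in> gHom C i X Y" for f
  proof -
    have z: "0 \<in> gHom C i X Y"
      by (simp add: gHom_def)
    have "D i X Y f = D i X Y 0"
      using u bij_betwE[OF D] f z by metis
    then show ?thesis
      using D f z by (meson bij_betw_def inj_onD)
  qed
  then show ?thesis
    by (auto simp: gHom_def)
qed

text \<open>The degree 0 part of the cohomology of the sphere is spanned by its unit, which
  corresponds to the identity of \<open>X\<close>.\<close>

lemma spherical_End:
  assumes "spherical C X" "a \<in> Hom C X X"
  shows "\<exists>c. a = smul C c (idm C X)"
proof -
  obtain \<Theta> :: "int \<Rightarrow> 'm \<Rightarrow> 'k poly" where all: "\<forall>i. bij_betw (\<Theta> i) (gHom C i X X) (S2_cohomology i)"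
    "\<forall>i c. \<forall>a\<in>gHom C i X X. \<Theta> i (smul C c a) = smult c (\<Theta> i a)" "\<Theta> 0 (idm C X) = 1"
    using assms(1) unfolding spherical_def all_conj_distrib
    by (elim exE conjE) (rule that, assumption+)
  note \<Theta> = all(1)[THEN spec[of _ 0]] all(2)[THEN spec[of _ 0]] all(3)
  have hom: "gHom C 0 X X = Hom C X X"
    by (simp add: gHom_def sh_0)
  obtain c where "\<Theta> 0 a = [:c:]"
    using bij_betwE[OF \<Theta>(1)] assms(2) hom by (auto simp: S2_cohomology_def)
  also have "\<dots> = \<Theta> 0 (smul C c (idm C X))"
    using \<Theta>(2,3) hom idm_in_Hom by (simp add: one_pCons)
  finally have "a = smul C c (idm C X)"
    using \<Theta>(1) hom assms(2) smul_in_Hom[OF idm_in_Hom] by (metis bij_betw_def inj_onD)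
  then show ?thesis by blast
qed

text \<open>A basis of the zero space is empty. This limits the shifts of \<open>X\<close> that
  occur in evaluation and coevaluation objects.\<close>

lemma homogeneous_basis_degree:
  assumes "homogeneous_basis C X Y B" "(i, f) \<in> B"
  shows "gHom C i X Y \<noteq> {0}"
proof
  assume "gHom C i X Y = {0}"
  then have span: "V.span {f. (i, f) \<in> B} = {0}" and ind: "\<not> V.dependent {f. (i, f) \<in> B}"
    using assms(1) unfolding homogeneous_basis_def by auto
  have "f = 0"
    using V.span_base[of f "{f. (i, f) \<in> B}"] assms(2) span by simp
  then show False
    using V.dependent_zero[of "{f. (i, f) \<in> B}"] assms(2) ind by simp
qed

lemma linear_functor_zero_object:
  assumes "linear_functor C Fo Fm" "zero_object C N"
  shows "zero_object C (Fo N)"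
proof -
  have "Fm (0 + 0) = Fm 0 + Fm 0"
    using assms(1) zero_in_Hom unfolding linear_functor_def by blast
  moreover have "idm C (Fo N) = Fm (idm C N)"
    using assms(1) unfolding linear_functor_def by metis
  ultimately show ?thesis
    using assms(2) by (simp add: zero_object_iff_idm)
qed

text \<open>Needed for the phases of the twisted objects to be meaningful. If \<open>Fo Y\<close>
  were zero, so would be \<open>Go (Fo Y)\<close>, which is isomorphic to \<open>Y\<close>.\<close>

lemma autoequivalence_nonzero:
  assumes "mutually_inverse_autoequivalences C Fo Fm Go Gm" "\<not> zero_object C Y"
  shows "\<not> zero_object C (Fo Y)" "\<not> zero_object C (Go Y)"
proof -
  have lin: "linear_functor C Fo Fm" "linear_functor C Go Gm"
    using assms(1) unfolding mutually_inverse_autoequivalences_def exact_functor_def by auto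
  obtain \<eta> \<epsilon> where "natural_iso C (\<lambda>X. Go (Fo X)) (\<lambda>f. Gm (Fm f)) (\<lambda>X. X) (\<lambda>f. f) \<eta>"
    "natural_iso C (\<lambda>X. Fo (Go X)) (\<lambda>f. Fm (Gm f)) (\<lambda>X. X) (\<lambda>f. f) \<epsilon>"
    using assms(1) unfolding mutually_inverse_autoequivalences_def by auto
  then have "isomorphic C (Go (Fo Y)) Y" "isomorphic C (Fo (Go Y)) Y"
    unfolding natural_iso_def isomorphic_def by blast+
  then show "\<not> zero_object C (Fo Y)" "\<not> zero_object C (Go Y)"
    using linear_functor_zero_object[OF lin(2), of "Fo Y"]
      linear_functor_zero_object[OF lin(1), of "Go Y"] zero_object_isomorphic assms(2) by blast+
qed

end

section \<open>Slicings and phases\<close>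

locale category_with_stability = triangulated_category C
  for C :: "('k::field, 'o, 'm::ab_group_add) tri_cat" (structure) +
  fixes P :: "real \<Rightarrow> 'o set" and Z :: "'o \<Rightarrow> complex"
  assumes stability: "stability_condition C P Z"
begin

text \<open>The objects with all Harder--Narasimhan phases at least \<open>t\<close>, together with
  zero objects. Expressed by vanishing of Hom, the condition needs no choice of filtration and
  visibly passes to extensions; \<open>ph_le\<close> is its dual.\<close>

definition ph_ge :: "real \<Rightarrow> 'o set" where
  "ph_ge t = {Y. \<forall>s<t. \<forall>B\<in>P s. Hom C Y B = {0}}"

definition ph_le :: "real \<Rightarrow> 'o set" where
  "ph_le t = {Y. \<forall>s>t. \<forall>A\<in>P s. Hom C A Y = {0}}"

lemma ph_geI: "(\<And>s B. \<lbrakk>s < t; B \<in> P s\<rbrakk> \<Longrightarrow> Hom C Y B = {0}) \<Longrightarrow> Y \<in> ph_ge t"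
  unfolding ph_ge_def by blast

lemma ph_geD: "\<lbrakk>Y \<in> ph_ge t; s < t; B \<in> P s\<rbrakk> \<Longrightarrow> Hom C Y B = {0}"
  unfolding ph_ge_def by blast

lemma ph_leI: "(\<And>s A. \<lbrakk>t < s; A \<in> P s\<rbrakk> \<Longrightarrow> Hom C A Y = {0}) \<Longrightarrow> Y \<in> ph_le t"
  unfolding ph_le_def by blast

lemma ph_leD: "\<lbrakk>Y \<in> ph_le t; t < s; A \<in> P s\<rbrakk> \<Longrightarrow> Hom C A Y = {0}"
  unfolding ph_le_def by blast

lemma P_isomorphic: "\<lbrakk>X \<in> P t; isomorphic C X Y\<rbrakk> \<Longrightarrow> Y \<in> P t"
  using stability unfolding stability_condition_def slicing_def by blast

lemma P_zero: "zero_object C X \<Longrightarrow> X \<in> P t"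
  using stability unfolding stability_condition_def slicing_def by blast

lemma P_shift1: "X\<lbrakk>1\<rbrakk> \<in> P (t + 1) \<longleftrightarrow> X \<in> P t"
  using stability unfolding stability_condition_def slicing_def by blast

lemma Hom_P: "\<lbrakk>t < s; A \<in> P s; B \<in> P t\<rbrakk> \<Longrightarrow> Hom C A B = {0}"
  using stability unfolding stability_condition_def slicing_def by blast

lemma ex_HN:
  assumes "\<not> zero_object C Y"
  obtains n E A ph where "HN_filtration C P Y n E A ph"
proof -
  have "\<exists>n E A ph. HN_filtration C P Y n E A ph"
    using stability assms unfolding stability_condition_def slicing_def by blast
  then show thesis
    using that by blast
qed

lemma Z_Tri: "Tri C A E B f g h \<Longrightarrow> Z E = Z A + Z B"
  using stability unfolding stability_condition_def central_charge_def by blast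

lemma Z_P:
  assumes "X \<in> P t" "\<not> zero_object C X"
  obtains m where "m > 0" "Z X = of_real m * cis (pi * t)"
  using stability assms unfolding stability_condition_def central_charge_def by blast

lemma Z_zero:
  assumes "zero_object C N"
  shows "Z N = 0"
  using Z_Tri[OF Tri_idm[OF assms, of N]] by simp

lemma P_shift: "X\<lbrakk>i\<rbrakk> \<in> P (t + of_int i) \<longleftrightarrow> X \<in> P t"
proof (induction i arbitrary: t rule: int_induct[where k = 0])
  case base
  then show ?case by (simp add: sh_0)
next
  case (step1 i)
  then show ?case
    using P_shift1[of "X\<lbrakk>i\<rbrakk>" "t + of_int i"] by (simp add: sh_sh algebra_simps)
next
  case (step2 i)
  then show ?case
    using P_shift1[of "X\<lbrakk>i - 1\<rbrakk>" "t + of_int (i - 1)"] by (simp add: sh_sh)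
qed

lemma P_shiftI: "\<lbrakk>X \<in> P t; s = t + of_int i\<rbrakk> \<Longrightarrow> X\<lbrakk>i\<rbrakk> \<in> P s"
  by (simp add: P_shift)

lemma P_ph_ge: "\<lbrakk>X \<in> P t; s \<le> t\<rbrakk> \<Longrightarrow> X \<in> ph_ge s"
  by (rule ph_geI) (rule Hom_P[OF less_le_trans])

lemma P_ph_le: "\<lbrakk>X \<in> P t; t \<le> s\<rbrakk> \<Longrightarrow> X \<in> ph_le s"
  by (rule ph_leI) (rule Hom_P[OF le_less_trans])

lemma ph_ge_shift:
  assumes "X \<in> ph_ge t" "s = t + of_int i"
  shows "X\<lbrakk>i\<rbrakk> \<in> ph_ge s"
proof (rule ph_geI)
  fix r B
  assume "r < s" "B \<in> P r"
  then have "B\<lbrakk>- i\<rbrakk> \<in> P (r - of_int i)" "r - of_int i < t"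
    using assms(2) by (auto intro: P_shiftI)
  then show "Hom C (X\<lbrakk>i\<rbrakk>) B = {0}"
    using ph_geD[OF assms(1)] by (simp add: Hom_shift_left)
qed

lemma ph_le_shift:
  assumes "X \<in> ph_le t" "s = t + of_int i"
  shows "X\<lbrakk>i\<rbrakk> \<in> ph_le s"
proof (rule ph_leI)
  fix r B
  assume "s < r" "B \<in> P r"
  then have "B\<lbrakk>- i\<rbrakk> \<in> P (r - of_int i)" "t < r - of_int i"
    using assms(2) by (auto intro: P_shiftI)
  then show "Hom C B (X\<lbrakk>i\<rbrakk>) = {0}"
    using ph_leD[OF assms(1)] Hom_shift_left[of B "- i" X] by simp
qed

lemma ph_ge_extension:
  "\<lbrakk>Tri C A E B f g h; A \<in> ph_ge t; B \<in> ph_ge t\<rbrakk> \<Longrightarrow> E \<in> ph_ge t"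
  by (rule ph_geI) (rule Hom_extension_left, assumption, (erule (2) ph_geD)+)

lemma ph_le_extension:
  "\<lbrakk>Tri C A E B f g h; A \<in> ph_le t; B \<in> ph_le t\<rbrakk> \<Longrightarrow> E \<in> ph_le t"
  by (rule ph_leI) (rule Hom_extension_right, assumption, (erule (2) ph_leD)+)

lemma ph_ge_zero: "zero_object C N \<Longrightarrow> N \<in> ph_ge t"
  by (rule P_ph_ge[OF P_zero order.refl])

lemma ph_le_zero: "zero_object C N \<Longrightarrow> N \<in> ph_le t"
  by (rule P_ph_le[OF P_zero order.refl])

lemma P_phase_unique:
  assumes "X \<in> P s" "X \<in> P t" "\<not> zero_object C X"
  shows "s = t"
proof (rule ccontr)
  assume "s \<noteq> t"
  then have "Hom C X X = {0}"
    using Hom_P[of s t X X] Hom_P[of t s X X] assms(1,2) by linarith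
  then show False
    using idm_in_Hom[of X] assms(3) by (simp add: zero_object_iff_idm)
qed

lemma phase_eq: "\<lbrakk>X \<in> P t; \<not> zero_object C X\<rbrakk> \<Longrightarrow> phase P X = t"
  unfolding phase_def using P_phase_unique by blast

section \<open>Harder--Narasimhan filtrations and the extreme phases\<close>

lemma HN_phase_decreasing:
  assumes "HN_filtration C P Y n E A ph" "i < j" "j < n"
  shows "ph j < ph i"
  using assms(2,3)
proof (induction j)
  case (Suc j)
  then have "ph (Suc j) < ph j"
    using assms(1) by (simp add: HN_filtration_def)
  with Suc show ?case
    by (cases "i = j") auto
qed simp

lemma HN_phase_bounds:
  assumes "HN_filtration C P Y n E A ph" "j < n"
  shows "ph (n - 1) \<le> ph j" "ph j \<le> ph 0"
proof -
  have "j = n - 1 \<or> j < n - 1" "j = 0 \<or> 0 < j"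
    using assms(2) by linarith+
  then show "ph (n - 1) \<le> ph j" "ph j \<le> ph 0"
    using HN_phase_decreasing[OF assms(1), of j "n - 1"] HN_phase_decreasing[OF assms(1), of 0 j] assms(2)
    by fastforce+
qed

lemma HN_step:
  assumes "HN_filtration C P Y n E A ph" "j < n"
  obtains f g h where "Tri C (E j) (E (Suc j)) (A j) f g h" "A j \<in> P (ph j)"
    "\<not> zero_object C (A j)"
  using assms by (auto simp: HN_filtration_def)

lemma HN_ph_ge:
  assumes "HN_filtration C P Y n E A ph" "j \<le> n" "\<And>i. i < j \<Longrightarrow> t \<le> ph i"
  shows "E j \<in> ph_ge t"
  using assms(2,3)
proof (induction j)
  case 0
  then show ?case
    using assms(1) by (simp add: HN_filtration_def ph_ge_zero)
next
  case (Suc j)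
  obtain f g h where "Tri C (E j) (E (Suc j)) (A j) f g h" "A j \<in> P (ph j)"
    using HN_step[OF assms(1) Suc_le_lessD[OF Suc.prems(1)]] by blast
  then show ?case
    using ph_ge_extension P_ph_ge Suc by (meson Suc_leD less_Suc_eq)
qed

lemma HN_ph_le:
  assumes "HN_filtration C P Y n E A ph" "j \<le> n" "\<And>i. i < j \<Longrightarrow> ph i \<le> t"
  shows "E j \<in> ph_le t"
  using assms(2,3)
proof (induction j)
  case 0
  then show ?case
    using assms(1) by (simp add: HN_filtration_def ph_le_zero)
next
  case (Suc j)
  obtain f g h where "Tri C (E j) (E (Suc j)) (A j) f g h" "A j \<in> P (ph j)"
    using HN_step[OF assms(1) Suc_le_lessD[OF Suc.prems(1)]] by blast
  then show ?case
    using ph_le_extension P_ph_le Suc by (meson Suc_leD less_Suc_eq)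
qed

text \<open>The map \<open>u\<close> is the composite of A 0 \<cong> E 1 -> ... -> E n. A step E j
  -> E (j+1) with j \<ge> 1 has cone \<open>A j\<close> of phase below \<open>ph 0\<close>, whereas
  W[1] has phases at least t + 1 > \<open>ph 0\<close>; so W[1] has no maps to the cone, and the
  step can be cancelled.\<close>

lemma HN_first:
  assumes HN: "HN_filtration C P Y n E A ph"
  obtains u where "u \<in> Hom C (A 0) Y"
    "\<And>W w. \<lbrakk>W \<in> ph_ge t; ph 0 - 1 < t; w \<in> Hom C W (A 0); u \<odot> w = 0\<rbrakk> \<Longrightarrow> w = 0"
proof -
  define good where "good u j \<longleftrightarrow> u \<in> Hom C (A 0) (E j) \<and>
    (\<forall>W w. W \<in> ph_ge t \<longrightarrow> ph 0 - 1 < t \<longrightarrow> w \<in> Hom C W (A 0) \<longrightarrow> u \<odot> w = 0 \<longrightarrow> w = 0)" for u j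
  have n: "0 < n" "zero_object C (E 0)" "E n = Y"
    using HN by (auto simp: HN_filtration_def)
  have "\<exists>u. good u (Suc j)" if "j < n" for j
    using that
  proof (induction j)
    case 0
    obtain f g h where tri: "Tri C (E 0) (E (Suc 0)) (A 0) f g h"
      using HN_step[OF HN 0] by blast
    obtain u where u: "is_iso C (A 0) (E (Suc 0)) u"
      using isomorphic_sym[OF Tri_iso_third[OF tri n(2)]] by (auto simp: isomorphic_def)
    then have "good u (Suc 0)"
      unfolding good_def using iso_cancel_left[OF u] by (auto simp: is_iso_def)
    then show ?case by blast
  next
    case (Suc j)
    then obtain u where u: "good u (Suc j)"
      by auto
    obtain f g h where tri: "Tri C (E (Suc j)) (E (Suc (Suc j))) (A (Suc j)) f g h"
      and A: "A (Suc j) \<in> P (ph (Suc j))"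
      using HN_step[OF HN Suc.prems] by blast
    have f: "f \<in> Hom C (E (Suc j)) (E (Suc (Suc j)))" and uH: "u \<in> Hom C (A 0) (E (Suc j))"
      using Tri_in_Hom[OF tri] u by (auto simp: good_def)
    have "w = 0" if W: "W \<in> ph_ge t" "ph 0 - 1 < t" and w: "w \<in> Hom C W (A 0)"
      "(f \<odot> u) \<odot> w = 0" for W w
    proof -
      have "W\<lbrakk>1\<rbrakk> \<in> ph_ge (t + 1)"
        using W(1) by (rule ph_ge_shift) simp
      moreover have "ph (Suc j) < t + 1"
        using HN_phase_decreasing[OF HN _ Suc.prems, of 0] W(2) by simp
      ultimately have "Hom C (W\<lbrakk>1\<rbrakk>) (A (Suc j)) = {0}"
        by (rule ph_geD[OF _ _ A])
      then have "u \<odot> w = 0"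
        using Tri_cancel_left[OF tri cmp_in_Hom[OF w(1) uH]] w(2) cmp_assoc[OF w(1) uH f] by simp
      then show "w = 0"
        using u W w(1) by (auto simp: good_def)
    qed
    then have "good (f \<odot> u) (Suc (Suc j))"
      using cmp_in_Hom[OF uH f] by (auto simp: good_def)
    then show ?case by blast
  qed
  from this[of "n - 1"] obtain u where "good u n"
    using n(1) by auto
  then show thesis
    using that n(3) by (auto simp: good_def)
qed

text \<open>Here \<open>u\<close> is the second map of the last triangle of the filtration. A map
  \<open>w\<close> killed by it factors through the shift by 1 of \<open>E (n - 1)\<close>, and no
  nonzero maps lead from there to \<open>W\<close>, for reasons of phase.\<close>

lemma HN_last:
  assumes HN: "HN_filtration C P Y n E A ph"
  obtains u where "u \<in> Hom C Y (A (n - 1))"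
    "\<And>W w. \<lbrakk>W \<in> ph_le t; t < ph (n - 1) + 1; w \<in> Hom C (A (n - 1)) W; w \<odot> u = 0\<rbrakk> \<Longrightarrow> w = 0"
proof -
  have n: "0 < n" "E n = Y"
    using HN by (auto simp: HN_filtration_def)
  then obtain f g h where tri: "Tri C (E (n - 1)) Y (A (n - 1)) f g h"
    using HN_step[OF HN, of "n - 1"] by (metis Suc_pred' diff_less zero_less_one)
  have "w = 0" if W: "W \<in> ph_le t" "t < ph (n - 1) + 1"
    and w: "w \<in> Hom C (A (n - 1)) W" "w \<odot> g = 0" for W w
  proof -
    have "W\<lbrakk>- 1\<rbrakk> \<in> ph_le (t - 1)"
      using W(1) by (rule ph_le_shift) simp
    \<comment> \<open>Each \<open>E j\<close> is an iterated extension of factors of phase at least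
      \<open>ph (n - 1)\<close>, which exceeds t - 1.\<close>
    moreover have "Hom C (E j) V = {0}" if "V \<in> ph_le (t - 1)" "j \<le> n" for V j
      using that(2)
    proof (induction j)
      case 0
      then show ?case
        using HN Hom_zero_object by (simp add: HN_filtration_def)
    next
      case (Suc j)
      obtain f g h where tri: "Tri C (E j) (E (Suc j)) (A j) f g h" and A: "A j \<in> P (ph j)"
        using HN_step[OF HN Suc_le_lessD[OF Suc.prems(1)]] by blast
      have "ph (n - 1) \<le> ph j"
        using HN_phase_bounds(1)[OF HN, of j] Suc.prems by simp
      then have "Hom C (A j) V = {0}"
        using ph_leD[OF that(1) _ A] W(2) by simp
      then show ?case
        using Hom_extension_left[OF tri] Suc by simp
    qed
    ultimately have "Hom C (E (n - 1)) (W\<lbrakk>- 1\<rbrakk>) = {0}"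
      by simp
    then have "Hom C ((E (n - 1))\<lbrakk>1\<rbrakk>) W = {0}"
      by (simp add: Hom_shift_left)
    then show ?thesis
      using Tri_cancel_right[OF tri w] by simp
  qed
  then show thesis
    using that Tri_in_Hom[OF tri] by blast
qed

text \<open>This characterizes \<open>ph 0\<close> independently of the filtration. If
  \<open>ph 0\<close> exceeded \<open>t\<close>, the map from \<open>A 0\<close> to \<open>Y\<close>
  would be zero; being left cancellable on maps from \<open>A 0\<close> itself, it would force
  \<open>A 0\<close> to be zero.\<close>

lemma HN_ph_le_iff:
  assumes HN: "HN_filtration C P Y n E A ph"
  shows "Y \<in> ph_le t \<longleftrightarrow> ph 0 \<le> t"
proof
  have n: "0 < n" "E n = Y"
    using HN by (auto simp: HN_filtration_def)
  show "ph 0 \<le> t" if Y: "Y \<in> ph_le t"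
  proof (rule ccontr)
    assume "\<not> ph 0 \<le> t"
    have A: "A 0 \<in> P (ph 0)" "\<not> zero_object C (A 0)"
      using HN_step[OF HN n(1)] by auto
    obtain u where u: "u \<in> Hom C (A 0) Y"
      "\<And>W w. \<lbrakk>W \<in> ph_ge (ph 0); ph 0 - 1 < ph 0; w \<in> Hom C W (A 0); u \<odot> w = 0\<rbrakk> \<Longrightarrow> w = 0"
      using HN_first[OF HN] by blast
    have "u = 0"
      using u(1) ph_leD[OF Y _ A(1)] \<open>\<not> ph 0 \<le> t\<close> by simp
    then have "idm C (A 0) = 0"
      using u(2)[OF P_ph_ge[OF A(1)] _ idm_in_Hom] cmp_zero_left[OF idm_in_Hom] by simp
    then show False
      using A(2) by (simp add: zero_object_iff_idm)
  qed
  show "Y \<in> ph_le t" if "ph 0 \<le> t"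
  proof -
    have "ph i \<le> t" if "i < n" for i
      using HN_phase_bounds(2)[OF HN that] \<open>ph 0 \<le> t\<close> by simp
    then show ?thesis
      using HN_ph_le[OF HN, of n t] n by simp
  qed
qed

lemma HN_ph_ge_iff:
  assumes HN: "HN_filtration C P Y n E A ph"
  shows "Y \<in> ph_ge t \<longleftrightarrow> t \<le> ph (n - 1)"
proof
  have n: "0 < n" "E n = Y"
    using HN by (auto simp: HN_filtration_def)
  show "t \<le> ph (n - 1)" if Y: "Y \<in> ph_ge t"
  proof (rule ccontr)
    assume "\<not> t \<le> ph (n - 1)"
    have A: "A (n - 1) \<in> P (ph (n - 1))" "\<not> zero_object C (A (n - 1))"
      using HN_step[OF HN, of "n - 1"] n(1) by auto
    obtain u where u: "u \<in> Hom C Y (A (n - 1))"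
      "\<And>W w. \<lbrakk>W \<in> ph_le (ph (n - 1)); ph (n - 1) < ph (n - 1) + 1; w \<in> Hom C (A (n - 1)) W;
        w \<odot> u = 0\<rbrakk> \<Longrightarrow> w = 0"
      using HN_last[OF HN] by blast
    have "u = 0"
      using u(1) ph_geD[OF Y _ A(1)] \<open>\<not> t \<le> ph (n - 1)\<close> by simp
    then have "idm C (A (n - 1)) = 0"
      using u(2)[OF P_ph_le[OF A(1)] _ idm_in_Hom] cmp_zero_right[OF idm_in_Hom] by simp
    then show False
      using A(2) by (simp add: zero_object_iff_idm)
  qed
  show "Y \<in> ph_ge t" if "t \<le> ph (n - 1)"
  proof -
    have "t \<le> ph i" if "i < n" for i
      using HN_phase_bounds(1)[OF HN that] \<open>t \<le> ph (n - 1)\<close> by simp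
    then show ?thesis
      using HN_ph_ge[OF HN, of n t] n by simp
  qed
qed

lemma phi_plus_HN:
  assumes "HN_filtration C P Y n E A ph"
  shows "phi_plus C P Y = ph 0"
  unfolding phi_plus_def
proof (rule the_equality)
  fix t assume "\<exists>n E A ph. HN_filtration C P Y n E A ph \<and> t = ph 0"
  then show "t = ph 0"
    using HN_ph_le_iff assms by (metis order.antisym order.refl)
qed (use assms in blast)

lemma phi_minus_HN:
  assumes "HN_filtration C P Y n E A ph"
  shows "phi_minus C P Y = ph (n - 1)"
  unfolding phi_minus_def
proof (rule the_equality)
  fix t assume "\<exists>n E A ph. HN_filtration C P Y n E A ph \<and> t = ph (n - 1)"
  then show "t = ph (n - 1)"
    using HN_ph_ge_iff assms by (metis order.antisym order.refl)
qed (use assms in blast)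

lemma phi_plus_le_iff: "\<not> zero_object C Y \<Longrightarrow> phi_plus C P Y \<le> t \<longleftrightarrow> Y \<in> ph_le t"
  by (metis ex_HN phi_plus_HN HN_ph_le_iff)

lemma phi_minus_ge_iff: "\<not> zero_object C Y \<Longrightarrow> t \<le> phi_minus C P Y \<longleftrightarrow> Y \<in> ph_ge t"
  by (metis ex_HN phi_minus_HN HN_ph_ge_iff)

text \<open>The membership of \<open>A\<close> controls maps to semistable objects; induction along
  a Harder--Narasimhan filtration of \<open>B\<close> extends this to \<open>B\<close>.\<close>

lemma Hom_ph_ge_ph_le:
  assumes "A \<in> ph_ge s" "B \<in> ph_le t" "t < s"
  shows "Hom C A B = {0}"
proof (cases "zero_object C B")
  case False
  then obtain n E A' ph where HN: "HN_filtration C P B n E A' ph"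
    by (rule ex_HN)
  have "ph 0 \<le> t"
    using HN_ph_le_iff[OF HN] assms(2) by simp
  have "Hom C A (E j) = {0}" if "j \<le> n" for j
    using that
  proof (induction j)
    case 0
    then show ?case
      using HN Hom_zero_object by (simp add: HN_filtration_def)
  next
    case (Suc j)
    obtain f g h where tri: "Tri C (E j) (E (Suc j)) (A' j) f g h" and A': "A' j \<in> P (ph j)"
      using HN_step[OF HN Suc_le_lessD[OF Suc.prems(1)]] by blast
    have "ph j \<le> t"
      using HN_phase_bounds(2)[OF HN, of j] Suc.prems \<open>ph 0 \<le> t\<close> by simp
    then show ?case
      using Hom_extension_right[OF tri] Suc ph_geD[OF assms(1) _ A'] assms(3) by simp
  qed
  then show ?thesis
    using HN by (auto simp: HN_filtration_def)
qed (simp add: Hom_zero_object)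

text \<open>The two bounds squeeze all Harder--Narasimhan phases to \<open>t\<close>. As these
  strictly decrease, there is only one factor, and it is isomorphic to \<open>X\<close>.\<close>

lemma P_iff_ph: "X \<in> P t \<longleftrightarrow> X \<in> ph_ge t \<and> X \<in> ph_le t"
proof
  assume X: "X \<in> ph_ge t \<and> X \<in> ph_le t"
  show "X \<in> P t"
  proof (cases "zero_object C X")
    case False
    then obtain n E A ph where HN: "HN_filtration C P X n E A ph"
      by (rule ex_HN)
    then have n: "0 < n" "zero_object C (E 0)" "E n = X"
      by (auto simp: HN_filtration_def)
    have bounds: "ph 0 \<le> t" "t \<le> ph (n - 1)"
      using HN_ph_le_iff[OF HN] HN_ph_ge_iff[OF HN] X by auto
    then have "n = 1"
      using HN_phase_decreasing[OF HN, of 0 "n - 1"] n(1) by force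
    obtain f g h where "Tri C (E 0) (E (Suc 0)) (A 0) f g h" "A 0 \<in> P (ph 0)"
      using HN_step[OF HN n(1)] by blast
    then show ?thesis
      using P_isomorphic[OF _ isomorphic_sym[OF Tri_iso_third]] n bounds \<open>n = 1\<close> by fastforce
  qed (rule P_zero)
qed (simp add: P_ph_ge P_ph_le)

lemma P_extension: "\<lbrakk>Tri C A E B f g h; A \<in> P t; B \<in> P t\<rbrakk> \<Longrightarrow> E \<in> P t"
  by (meson P_iff_ph ph_ge_extension ph_le_extension)

section \<open>Subobjects and quotients of a semistable object\<close>

lemma Z_HN:
  assumes HN: "HN_filtration C P Y n E A ph"
  shows "Z Y = (\<Sum>j<n. Z (A j))"
proof -
  have "Z (E j) = (\<Sum>i<j. Z (A i))" if "j \<le> n" for j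
    using that
  proof (induction j)
    case 0
    then show ?case
      using HN Z_zero by (simp add: HN_filtration_def)
  next
    case (Suc j)
    obtain f g h where "Tri C (E j) (E (Suc j)) (A j) f g h"
      using HN_step[OF HN Suc_le_lessD[OF Suc.prems(1)]] by blast
    then show ?case
      using Z_Tri Suc by simp
  qed
  then show ?thesis
    using HN by (auto simp: HN_filtration_def)
qed

text \<open>The phase of the cone can only be \<open>t\<close> or \<open>t + 1\<close>, because its central charge lies on the line
  through that of the objects of \<open>P t\<close>, while all its phases lie in the interval \<open>[t, t + 1]\<close>.\<close>

lemma HN_top_phase_of_cone:
  assumes tri: "Tri C A' A K f g h" and A': "A' \<in> P t" and A: "A \<in> P t"
    and HN: "HN_filtration C P K n E B ph"
  shows "ph 0 = t \<or> ph 0 = t + 1"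
proof -
  \<comment> \<open>Rotation by the angle -\<pi>t puts the central charges of \<open>P t\<close> on
    the real axis, so \<open>q\<close> vanishes there; on semistable objects with phase in
    [t, t + 1] it is nonnegative.\<close>
  define q where "q W = Im (Z W * cis (- (pi * t)))" for W
  have q_P: "\<exists>m>0. q W = m * sin (pi * (s - t))" if W: "W \<in> P s" "\<not> zero_object C W" for W s
  proof -
    obtain m where "m > 0" "Z W = of_real m * cis (pi * s)"
      using W by (rule Z_P)
    moreover have "pi * s + - (pi * t) = pi * (s - t)"
      by (simp add: right_diff_distrib)
    ultimately have "q W = m * sin (pi * (s - t))"
      by (simp only: q_def mult.assoc cis_mult) simp
    with \<open>m > 0\<close> show ?thesis by blast
  qed
  have q0: "q W = 0" if "W \<in> P t" for W
    using q_P[OF that] Z_zero[of W] by (cases "zero_object C W") (auto simp: q_def)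
  have n: "0 < n"
    using HN by (simp add: HN_filtration_def)
  have A'1: "A'\<lbrakk>1\<rbrakk> \<in> P (t + 1)"
    using A' by (simp add: P_shift1)
  have "K \<in> ph_ge t" "K \<in> ph_le (t + 1)"
    using ph_ge_extension[OF Tri_rotated[OF tri] P_ph_ge[OF A order.refl] P_ph_ge[OF A'1]]
      ph_le_extension[OF Tri_rotated[OF tri] P_ph_le[OF A] P_ph_le[OF A'1 order.refl]]
    by simp_all
  then have bounds: "t \<le> ph j" "ph j \<le> t + 1" if "j < n" for j
    using HN_ph_ge_iff[OF HN, of t] HN_ph_le_iff[OF HN, of "t + 1"] HN_phase_bounds[OF HN that]
    by linarith+
  have step: "\<exists>m>0. q (B j) = m * sin (pi * (ph j - t))" if "j < n" for j
    using HN_step[OF HN that] q_P by metis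
  have nonneg: "0 \<le> q (B j)" if "j < n" for j
  proof -
    have "0 \<le> sin (pi * (ph j - t))"
      using bounds[OF that] by (intro sin_ge_zero) (auto simp: mult_le_cancel_left1)
    then show ?thesis
      using step[OF that] by fastforce
  qed
  have "q K = q A - q A'"
    using Z_Tri[OF tri] by (simp add: q_def algebra_simps)
  moreover have "q K = (\<Sum>j<n. q (B j))"
    by (simp add: q_def Z_HN[OF HN] sum_distrib_right)
  \<comment> \<open>A vanishing sum of nonnegative terms has only zero terms, and the sine vanishes
    on [0, \<pi>] only at the endpoints.\<close>
  ultimately have "(\<Sum>j<n. q (B j)) = 0"
    using q0 A A' by simp
  then have "q (B 0) = 0"
    using sum_nonneg_eq_0_iff[of "{..<n}" "\<lambda>j. q (B j)"] nonneg n by simp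
  then have "sin (pi * (ph 0 - t)) = 0"
    using step[OF n] by auto
  moreover have "0 < sin (pi * (ph 0 - t))" if "t < ph 0" "ph 0 < t + 1"
    using that by (intro sin_gt_zero) (auto simp: mult_less_cancel_left1)
  ultimately show ?thesis
    using bounds[OF n] by force
qed

text \<open>A monomorphism of \<open>P t\<close> has its cokernel in \<open>P t\<close>. Otherwise
  the first factor \<open>B 0\<close> of the cone has phase t + 1. Its map to A'[1], shifted back,
  is killed by \<open>f\<close>, hence zero. So \<open>B 0\<close> -> \<open>K\<close> comes from a
  map \<open>B 0\<close> -> \<open>A\<close>, which vanishes because t + 1 > t.\<close>

lemma P_cone_of_mono:
  assumes tri: "Tri C A' A K f g h" and A': "A' \<in> P t" and A: "A \<in> P t"
    and mono: "\<And>T s. \<lbrakk>T \<in> P t; s \<in> Hom C T A'; f \<odot> s = 0\<rbrakk> \<Longrightarrow> s = 0"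
  shows "K \<in> P t"
proof (cases "zero_object C K")
  case False
  then obtain n E B ph where HN: "HN_filtration C P K n E B ph"
    by (rule ex_HN)
  have n: "0 < n"
    using HN by (simp add: HN_filtration_def)
  have B: "B 0 \<in> P (ph 0)" "\<not> zero_object C (B 0)"
    using HN_step[OF HN n] by auto
  have hom: "f \<in> Hom C A' A" "g \<in> Hom C A K" "h \<in> Hom C K (A'\<lbrakk>1\<rbrakk>)"
    using Tri_in_Hom[OF tri] by auto
  have "ph 0 \<noteq> t + 1"
  proof
    assume top: "ph 0 = t + 1"
    obtain u where u: "u \<in> Hom C (B 0) K"
      "\<And>W w. \<lbrakk>W \<in> ph_ge (ph 0); ph 0 - 1 < ph 0; w \<in> Hom C W (B 0); u \<odot> w = 0\<rbrakk> \<Longrightarrow> w = 0"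
      using HN_first[OF HN] by blast
    define v where "v = shm C (h \<odot> u) (-1)"
    have hu: "h \<odot> u \<in> Hom C (B 0) (A'\<lbrakk>1\<rbrakk>)"
      by (rule cmp_in_Hom[OF u(1) hom(3)])
    then have v: "v \<in> Hom C ((B 0)\<lbrakk>- 1\<rbrakk>) A'"
      using shm_in_Hom[OF hu, of "-1"] by (simp add: v_def sh_sh sh_0)
    have v1: "shm C v 1 = h \<odot> u"
      using shm_shm[OF hu, of "-1" 1] shm_0[OF hu] by (simp add: v_def)
    have "shm C f 1 \<odot> h = 0"
      using Tri_cmp_zero[OF Tri_rotated[OF Tri_rotated[OF tri]]]
        cmp_uminus_left[OF hom(3) shm_in_Hom[OF hom(1)]] by simp
    then have "shm C (f \<odot> v) 1 = 0"
      using shm_cmp[OF v hom(1), of 1] v1 cmp_assoc[OF u(1) hom(3) shm_in_Hom[OF hom(1)]] u(1)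
      by simp
    then have "f \<odot> v = 0"
      using shm_eq_0[OF cmp_in_Hom[OF v hom(1)]] by simp
    moreover have "(B 0)\<lbrakk>- 1\<rbrakk> \<in> P t"
      using B(1) by (rule P_shiftI) (simp add: top)
    ultimately have "v = 0"
      using mono v by blast
    then have "h \<odot> u = 0"
      using v1 by simp
    then obtain s where s: "s \<in> Hom C (B 0) A" "g \<odot> s = u"
      using Tri_lift[OF Tri_rotated[OF tri] u(1)] by blast
    have "s = 0"
      using s(1) Hom_P[OF _ B(1) A] top by simp
    then have "u = 0"
      using s(2) hom(2) by simp
    then have "idm C (B 0) = 0"
      using u(2)[OF P_ph_ge[OF B(1)] _ idm_in_Hom] cmp_zero_left[OF idm_in_Hom] by simp
    then show False
      using B(2) by (simp add: zero_object_iff_idm)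
  qed
  then have "K \<in> ph_le t"
    using HN_top_phase_of_cone[OF tri A' A HN] HN_ph_le_iff[OF HN] by simp
  moreover have "K \<in> ph_ge t"
    by (rule ph_ge_extension[OF Tri_rotated[OF tri] P_ph_ge[OF A order.refl]
        P_ph_ge[OF P_shiftI[OF A' refl]]]) simp
  ultimately show ?thesis
    by (simp add: P_iff_ph)
qed (rule P_zero)

lemma P_interval_ph_ge:
  assumes "T \<in> P_interval C P I" "\<And>s. s \<in> I \<Longrightarrow> t \<le> s"
  shows "T \<in> ph_ge t"
  using assms(1)
proof induction
  case (base s X)
  then show ?case
    using P_ph_ge assms(2) by blast
next
  case (extension A E B f g h)
  then show ?case
    using ph_ge_extension by blast
qed

text \<open>The phases of T[1] are at least r + 1 > t, so there are no nonzero maps T[1] -> K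
  obstructing cancellation.\<close>

lemma Tri_P_mono:
  assumes "Tri C A' A K f g h" "K \<in> P t" "T \<in> ph_ge r" "t - 1 < r" "s \<in> Hom C T A'" "f \<odot> s = 0"
  shows "s = 0"
proof -
  have "T\<lbrakk>1\<rbrakk> \<in> ph_ge (r + 1)"
    using assms(3) by (rule ph_ge_shift) simp
  then have "Hom C (T\<lbrakk>1\<rbrakk>) K = {0}"
    by (rule ph_geD[OF _ _ assms(2)]) (use assms(4) in simp)
  then show ?thesis
    using Tri_cancel_left assms by blast
qed

text \<open>Local finiteness concerns kernels in an interval category rather than in
  \<open>P t\<close>. The triangle gives liftings; they are unique because every test object there
  has phases above t - 1.\<close>

lemma strict_subobject_P:
  assumes tri: "Tri C A' A K f g h" and "A' \<in> P t" "A \<in> P t" "K \<in> P t" and \<eta>: "0 < \<eta>" "\<eta> < 1"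
  shows "strict_subobject C (P_interval C P {t - \<eta><..<t + \<eta>}) A' A f"
proof -
  let ?S = "P_interval C P {t - \<eta><..<t + \<eta>}"
  have in_S: "B \<in> ?S" if "B \<in> P t" for B
    using that \<eta>(1) by (intro P_interval.base[of t]) auto
  have f: "f \<in> Hom C A' A"
    using Tri_in_Hom[OF tri] by simp
  have "\<exists>!s. s \<in> Hom C T A' \<and> f \<odot> s = x" if T: "T \<in> ?S" and x: "x \<in> Hom C T A" "g \<odot> x = 0" for T x
  proof -
    obtain s where s: "s \<in> Hom C T A'" "f \<odot> s = x"
      using Tri_lift[OF tri x] by blast
    have "s' = s" if s': "s' \<in> Hom C T A'" "f \<odot> s' = x" for s'
    proof -
      have "T \<in> ph_ge (t - \<eta>)"
        using P_interval_ph_ge[OF T] by simp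
      moreover have "f \<odot> (s' - s) = 0"
        using cmp_diff_right[OF s'(1) s(1) f] s s' by simp
      ultimately have "s' - s = 0"
        using Tri_P_mono[OF tri assms(4) _ _ diff_in_Hom[OF s'(1) s(1)]] \<eta>(2) by simp
      then show ?thesis by simp
    qed
    with s show ?thesis by blast
  qed
  then have "kernel_in C ?S A' A K f g"
    using Tri_in_Hom[OF tri] Tri_cmp_zero[OF tri] in_S assms unfolding kernel_in_def by blast
  then show ?thesis
    unfolding strict_subobject_def by blast
qed

lemma ex_finite_length:
  obtains \<eta> where "0 < \<eta>" "\<eta> < 1" "\<And>t. finite_length C (P_interval C P {t - \<eta><..<t + \<eta>})"
proof -
  obtain \<eta> where "\<eta> > 0" "2 * \<eta> < 1" "\<forall>t. finite_length C (P_interval C P {t - \<eta><..<t + \<eta>})"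
    using stability unfolding stability_condition_def locally_finite_def by blast
  then show thesis
    using that[of \<eta>] by simp
qed

lemma not_simple_subobject:
  assumes "M \<in> P t" "\<not> zero_object C M" "\<not> simple_in C (P t) M"
  obtains A K f g h where "Tri C A M K f g h" "A \<in> P t" "K \<in> P t" "\<not> zero_object C A"
    "\<not> is_iso C A M f"
    "\<And>T s. \<lbrakk>T \<in> P t; s \<in> Hom C T A; f \<odot> s = 0\<rbrakk> \<Longrightarrow> s = 0"
proof -
  obtain A f where A: "A \<in> P t" "\<not> zero_object C A" "\<not> is_iso C A M f" and f: "f \<in> Hom C A M"
    and mono: "\<forall>T\<in>P t. \<forall>s\<in>Hom C T A. \<forall>s'\<in>Hom C T A. f \<odot> s = f \<odot> s' \<longrightarrow> s = s'"
    using assms unfolding simple_in_def by blast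
  have mono': "s = 0" if "T \<in> P t" "s \<in> Hom C T A" "f \<odot> s = 0" for T s
    using mono that cmp_zero_right[OF f] zero_in_Hom by metis
  obtain K g h where tri: "Tri C A M K f g h"
    using ex_cone[OF f] by blast
  show thesis
    using that[OF tri A(1) P_cone_of_mono[OF tri A(1) assms(1) mono'] A(2,3) mono'] .
qed

text \<open>Without a simple subobject, each nonzero subobject properly contains another one. The
  resulting infinite descending chain contradicts the artinian condition.\<close>

lemma ex_simple_subobject:
  assumes A: "A \<in> P t" "\<not> zero_object C A"
  obtains S K f g h where "Tri C S A K f g h" "S \<in> P t" "K \<in> P t" "simple_in C (P t) S"
proof (rule ccontr)
  note found = that
  assume "\<not> thesis"
  then have no_simple: "\<not> simple_in C (P t) S"
    if "Tri C S A K f g h" "S \<in> P t" "K \<in> P t" for S K f g h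
    using that found \<open>\<not> thesis\<close> by blast
  define sub where "sub M a \<longleftrightarrow> M \<in> P t \<and> \<not> zero_object C M \<and> a \<in> Hom C M A \<and>
    (\<forall>T\<in>P t. \<forall>s\<in>Hom C T M. a \<odot> s = 0 \<longrightarrow> s = 0)" for M a
  have cone: "\<exists>K g h. Tri C M A K a g h \<and> K \<in> P t" if sub: "sub M a" for M a
  proof -
    obtain K g h where tri: "Tri C M A K a g h"
      using ex_cone sub unfolding sub_def by blast
    moreover have "K \<in> P t"
      by (rule P_cone_of_mono[OF tri _ A(1)]) (use sub in \<open>auto simp: sub_def\<close>)
    ultimately show ?thesis by blast
  qed
  have step: "\<exists>M' a'. sub M' a' \<and> (\<exists>u\<in>Hom C M' M. a \<odot> u = a' \<and> \<not> is_iso C M' M u)"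
    if sub: "sub M a" for M a
  proof -
    have M: "M \<in> P t" "\<not> zero_object C M" "a \<in> Hom C M A"
      and mono: "\<And>T s. \<lbrakk>T \<in> P t; s \<in> Hom C T M; a \<odot> s = 0\<rbrakk> \<Longrightarrow> s = 0"
      using sub by (auto simp: sub_def)
    have "\<not> simple_in C (P t) M"
      using cone[OF sub] no_simple M(1) by blast
    then obtain M' K u g h where M': "Tri C M' M K u g h" "M' \<in> P t" "K \<in> P t"
      "\<not> zero_object C M'" "\<not> is_iso C M' M u"
      "\<And>T s. \<lbrakk>T \<in> P t; s \<in> Hom C T M'; u \<odot> s = 0\<rbrakk> \<Longrightarrow> s = 0"
      using not_simple_subobject[OF M(1,2)] by blast
    have u: "u \<in> Hom C M' M"
      using Tri_in_Hom[OF M'(1)] by simp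
    have "s = 0" if "T \<in> P t" "s \<in> Hom C T M'" "(a \<odot> u) \<odot> s = 0" for T s
      using that M'(6) mono[OF that(1) cmp_in_Hom[OF that(2) u]] cmp_assoc[OF that(2) u M(3)]
      by simp
    then have "sub M' (a \<odot> u)"
      using M' cmp_in_Hom[OF u M(3)] by (auto simp: sub_def)
    then show ?thesis
      using u M'(5) by blast
  qed
  have "sub A (idm C A)"
    unfolding sub_def using A cmp_idm_left idm_in_Hom by metis
  \<comment> \<open>Dependent choice runs over pairs of an object and its monomorphism to
    \<open>A\<close>.\<close>
  then have "\<exists>F. \<forall>n. case_prod sub (F n) \<and> (\<exists>u\<in>Hom C (fst (F (Suc n))) (fst (F n)).
      snd (F n) \<odot> u = snd (F (Suc n)) \<and> \<not> is_iso C (fst (F (Suc n))) (fst (F n)) u)"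
    using dependent_nat_choice[of "\<lambda>_. case_prod sub" "\<lambda>_ x y. \<exists>u\<in>Hom C (fst y) (fst x).
      snd x \<odot> u = snd y \<and> \<not> is_iso C (fst y) (fst x) u"] step by fastforce
  then obtain F where F: "\<And>n. sub (fst (F n)) (snd (F n))"
    "\<forall>n. \<exists>u\<in>Hom C (fst (F (Suc n))) (fst (F n)).
      snd (F n) \<odot> u = snd (F (Suc n)) \<and> \<not> is_iso C (fst (F (Suc n))) (fst (F n)) u"
    by (auto simp: case_prod_unfold)
  from F(2) obtain u where u: "\<And>n. u n \<in> Hom C (fst (F (Suc n))) (fst (F n))"
    "\<And>n. snd (F n) \<odot> u n = snd (F (Suc n))" "\<And>n. \<not> is_iso C (fst (F (Suc n))) (fst (F n)) (u n)"
    by metis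
  obtain \<eta> where \<eta>: "0 < \<eta>" "\<eta> < 1" "\<And>t. finite_length C (P_interval C P {t - \<eta><..<t + \<eta>})"
    using ex_finite_length by blast
  have "A \<in> P_interval C P {t - \<eta><..<t + \<eta>}"
    using A(1) \<eta>(1) by (intro P_interval.base[of t]) auto
  then have "artinian_object C (P_interval C P {t - \<eta><..<t + \<eta>}) A"
    using \<eta>(3) by (simp add: finite_length_def)
  moreover have "strict_subobject C (P_interval C P {t - \<eta><..<t + \<eta>}) (fst (F n)) A (snd (F n))" for n
    using cone[OF F(1)] strict_subobject_P[OF _ _ A(1) _ \<eta>(1,2)] F(1) unfolding sub_def by blast
  ultimately have "\<exists>N. \<forall>n\<ge>N. is_iso C (fst (F (Suc n))) (fst (F n)) (u n)"
    using u(1,2) unfolding artinian_object_def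
    by (elim allE[of _ "\<lambda>n. fst (F n)"] allE[of _ "\<lambda>n. snd (F n)"] allE[of _ u]) blast
  then show False
    using u(3) by blast
qed

text \<open>Quotients are replaced by their kernels. If a quotient \<open>D\<close> is not simple,
  dividing it by a proper nonzero subobject \<open>M\<close> enlarges the kernel, and the ascending
  chain contradicts the noetherian condition.\<close>

lemma ex_simple_quotient:
  assumes A: "A \<in> P t" "\<not> zero_object C A"
  obtains N S f g h where "Tri C N A S f g h" "N \<in> P t" "S \<in> P t" "simple_in C (P t) S"
proof (rule ccontr)
  note found = that
  assume "\<not> thesis"
  then have no_simple: "\<not> simple_in C (P t) S"
    if "Tri C N A S f g h" "N \<in> P t" "S \<in> P t" for N S f g h
    using that found \<open>\<not> thesis\<close> by blast
  define ker where "ker N a \<longleftrightarrow> N \<in> P t \<and>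
    (\<exists>D p r. Tri C N A D a p r \<and> D \<in> P t \<and> \<not> zero_object C D)" for N a
  have step: "\<exists>N' a'. ker N' a' \<and> (\<exists>u\<in>Hom C N N'. a' \<odot> u = a \<and> \<not> is_iso C N N' u)"
    if ker: "ker N a" for N a
  proof -
    obtain D p r where D: "Tri C N A D a p r" "N \<in> P t" "D \<in> P t" "\<not> zero_object C D"
      using ker by (auto simp: ker_def)
    obtain M K m g k where M: "Tri C M D K m g k" "M \<in> P t" "K \<in> P t" "\<not> zero_object C M"
      "\<not> is_iso C M D m"
      by (rule not_simple_subobject[OF D(3,4) no_simple[OF D(1-3)]]) (rule that)
    obtain N' a' r' u v w where N': "Tri C N' A K a' (g \<odot> p) r'" "u \<in> Hom C N N'" "a' \<odot> u = a"
      "Tri C (N\<lbrakk>1\<rbrakk>) (N'\<lbrakk>1\<rbrakk>) (M\<lbrakk>1\<rbrakk>) (shm C u 1) v w"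
      by (rule Tri_kernel_cmp[OF D(1) M(1)])
    have "N' \<in> P t"
      \<comment> \<open>The triangle relating the kernels is available only after a shift by 1,
        hence the phase t + 1.\<close>
      using P_extension[OF N'(4), of "t + 1"] D(2) M(2) by (simp add: P_shift1)
    moreover have "\<not> zero_object C K"
      using Tri_is_iso[OF M(1)] M(5) by blast
    ultimately have "ker N' a'"
      unfolding ker_def using N'(1) M(3) by blast
    \<comment> \<open>The cone of u[1] is M[1], which is nonzero.\<close>
    moreover have "\<not> is_iso C N N' u"
      using zero_object_cone_iso[OF N'(4) is_iso_shift] M(4) by (auto simp: zero_object_shift)
    ultimately show ?thesis
      using N'(2,3) by blast
  qed
  obtain N0 where "zero_object C N0"
    using ex_zero by blast
  \<comment> \<open>The chain starts with the zero kernel, whose quotient is \<open>A\<close>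
    itself.\<close>
  then have "ker N0 0"
    unfolding ker_def using Tri_zero_idm P_zero A by blast
  then have "\<exists>F. \<forall>n. case_prod ker (F n) \<and> (\<exists>u\<in>Hom C (fst (F n)) (fst (F (Suc n))).
      snd (F (Suc n)) \<odot> u = snd (F n) \<and> \<not> is_iso C (fst (F n)) (fst (F (Suc n))) u)"
    using dependent_nat_choice[of "\<lambda>_. case_prod ker" "\<lambda>_ x y. \<exists>u\<in>Hom C (fst x) (fst y).
      snd y \<odot> u = snd x \<and> \<not> is_iso C (fst x) (fst y) u"] step by fastforce
  then obtain F where F: "\<And>n. ker (fst (F n)) (snd (F n))"
    "\<forall>n. \<exists>u\<in>Hom C (fst (F n)) (fst (F (Suc n))).
      snd (F (Suc n)) \<odot> u = snd (F n) \<and> \<not> is_iso C (fst (F n)) (fst (F (Suc n))) u"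
    by (auto simp: case_prod_unfold)
  from F(2) obtain u where u: "\<And>n. u n \<in> Hom C (fst (F n)) (fst (F (Suc n)))"
    "\<And>n. snd (F (Suc n)) \<odot> u n = snd (F n)" "\<And>n. \<not> is_iso C (fst (F n)) (fst (F (Suc n))) (u n)"
    by metis
  obtain \<eta> where \<eta>: "0 < \<eta>" "\<eta> < 1" "\<And>t. finite_length C (P_interval C P {t - \<eta><..<t + \<eta>})"
    using ex_finite_length by blast
  have "A \<in> P_interval C P {t - \<eta><..<t + \<eta>}"
    using A(1) \<eta>(1) by (intro P_interval.base[of t]) auto
  then have "noetherian_object C (P_interval C P {t - \<eta><..<t + \<eta>}) A"
    using \<eta>(3) by (simp add: finite_length_def)
  moreover have "strict_subobject C (P_interval C P {t - \<eta><..<t + \<eta>}) (fst (F n)) A (snd (F n))" for n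
    using F(1) strict_subobject_P[OF _ _ A(1) _ \<eta>(1,2)] unfolding ker_def by blast
  ultimately have "\<exists>N. \<forall>n\<ge>N. is_iso C (fst (F n)) (fst (F (Suc n))) (u n)"
    using u(1,2) unfolding noetherian_object_def
    by (elim allE[of _ "\<lambda>n. fst (F n)"] allE[of _ "\<lambda>n. snd (F n)"] allE[of _ u]) blast
  then show False
    using u(3) by blast
qed

section \<open>Spherical twists and phases\<close>

lemma Hom_to_stable_zero:
  assumes X: "X \<in> P t" "\<And>a. a \<in> Hom C X X \<Longrightarrow> \<exists>c. a = smul C c (idm C X)"
    and unique: "\<And>S. simple_in C (P t) S \<Longrightarrow> isomorphic C S X"
    and Y: "\<not> zero_object C Y" "\<And>a. a \<in> Hom C Y Y \<Longrightarrow> \<exists>c. a = smul C c (idm C Y)"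
    and phases: "phi_plus C P Y = t" "t - 1 < phi_minus C P Y"
    and not_summand: "\<not> direct_summand C X Y"
  shows "Hom C Y X = {0}"
proof -
  obtain n E A ph where HN: "HN_filtration C P Y n E A ph"
    using Y(1) by (rule ex_HN)
  have Y_ge: "Y \<in> ph_ge (phi_minus C P Y)"
    using phi_minus_ge_iff[OF Y(1)] by blast
  have ph0: "ph 0 = t"
    using phi_plus_HN[OF HN] phases(1) by simp
  have "0 < n"
    using HN by (simp add: HN_filtration_def)
  then have A: "A 0 \<in> P t" "\<not> zero_object C (A 0)"
    using HN_step[OF HN, of 0] ph0 by auto
  \<comment> \<open>The lower bound is \<open>phi_minus C P Y\<close>, so that \<open>u\<close> can
    be cancelled against maps whose source is \<open>Y\<close>.\<close>
  obtain u where u: "u \<in> Hom C (A 0) Y"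
    "\<And>W w. \<lbrakk>W \<in> ph_ge (phi_minus C P Y); ph 0 - 1 < phi_minus C P Y; w \<in> Hom C W (A 0);
      u \<odot> w = 0\<rbrakk> \<Longrightarrow> w = 0"
    using HN_first[OF HN] by blast
  obtain S K i p r where S: "Tri C S (A 0) K i p r" "S \<in> P t" "K \<in> P t" "simple_in C (P t) S"
    using A by (rule ex_simple_subobject)
  obtain j where j: "is_iso C X S j"
    using isomorphic_sym[OF unique[OF S(4)]] by (auto simp: isomorphic_def)
  have hom: "i \<in> Hom C S (A 0)" "j \<in> Hom C X S"
    using Tri_in_Hom[OF S(1)] j by (auto simp: is_iso_def)
  have ij: "i \<odot> j \<in> Hom C X (A 0)"
    by (rule cmp_in_Hom[OF hom(2,1)])
  have "f = 0" if f: "f \<in> Hom C Y X" for f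
  proof -
    have "(u \<odot> (i \<odot> j)) \<odot> f = 0"
      using direct_summand_of_nonzero_cmp[OF X(2) Y(2) f cmp_in_Hom[OF ij u(1)]] not_summand
      by blast
    then have "u \<odot> ((i \<odot> j) \<odot> f) = 0"
      by (simp add: cmp_assoc[OF f ij u(1)])
    then have "(i \<odot> j) \<odot> f = 0"
      using u(2)[OF Y_ge _ cmp_in_Hom[OF f ij]] phases(2) ph0 by simp
    then have "i \<odot> (j \<odot> f) = 0"
      by (simp add: cmp_assoc[OF f hom(2,1)])
    then have "j \<odot> f = 0"
      using Tri_P_mono[OF S(1,3) Y_ge phases(2) cmp_in_Hom[OF f hom(2)]] by simp
    then show ?thesis
      using iso_cancel_left[OF j f] by simp
  qed
  then show ?thesis by auto
qed

lemma Hom_from_stable_zero: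
  assumes X: "X \<in> P t" "\<And>a. a \<in> Hom C X X \<Longrightarrow> \<exists>c. a = smul C c (idm C X)"
    and unique: "\<And>S. simple_in C (P t) S \<Longrightarrow> isomorphic C S X"
    and Y: "\<not> zero_object C Y" "\<And>a. a \<in> Hom C Y Y \<Longrightarrow> \<exists>c. a = smul C c (idm C Y)"
    and phases: "phi_minus C P Y = t" "phi_plus C P Y < t + 1"
    and not_summand: "\<not> direct_summand C X Y"
  shows "Hom C X Y = {0}"
proof -
  obtain n E A ph where HN: "HN_filtration C P Y n E A ph"
    using Y(1) by (rule ex_HN)
  have Y_le: "Y \<in> ph_le (phi_plus C P Y)"
    using phi_plus_le_iff[OF Y(1)] by blast
  have ph_last: "ph (n - 1) = t"
    using phi_minus_HN[OF HN] phases(1) by simp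
  have "n - 1 < n"
    using HN by (simp add: HN_filtration_def)
  then have A: "A (n - 1) \<in> P t" "\<not> zero_object C (A (n - 1))"
    using HN_step[OF HN, of "n - 1"] ph_last by auto
  obtain u where u: "u \<in> Hom C Y (A (n - 1))"
    "\<And>W w. \<lbrakk>W \<in> ph_le (phi_plus C P Y); phi_plus C P Y < ph (n - 1) + 1;
      w \<in> Hom C (A (n - 1)) W; w \<odot> u = 0\<rbrakk> \<Longrightarrow> w = 0"
    using HN_last[OF HN] by blast
  obtain N S a p r where S: "Tri C N (A (n - 1)) S a p r" "N \<in> P t" "S \<in> P t" "simple_in C (P t) S"
    using A by (rule ex_simple_quotient)
  obtain j where j: "is_iso C S X j"
    using unique[OF S(4)] by (auto simp: isomorphic_def)
  have hom: "p \<in> Hom C (A (n - 1)) S" "j \<in> Hom C S X"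
    using Tri_in_Hom[OF S(1)] j by (auto simp: is_iso_def)
  have jp: "j \<odot> p \<in> Hom C (A (n - 1)) X"
    by (rule cmp_in_Hom[OF hom])
  have N1: "N\<lbrakk>1\<rbrakk> \<in> P (t + 1)"
    using S(2) by (simp add: P_shift1)
  have "f = 0" if f: "f \<in> Hom C X Y" for f
  proof -
    have "f \<odot> ((j \<odot> p) \<odot> u) = 0"
      using direct_summand_of_nonzero_cmp[OF X(2) Y(2) cmp_in_Hom[OF u(1) jp] f] not_summand
      by blast
    then have "(f \<odot> (j \<odot> p)) \<odot> u = 0"
      by (simp add: cmp_assoc[OF u(1) jp f])
    then have "f \<odot> (j \<odot> p) = 0"
      using u(2)[OF Y_le _ cmp_in_Hom[OF jp f]] phases(2) ph_last by simp
    then have "(f \<odot> j) \<odot> p = 0"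
      by (simp add: cmp_assoc[OF hom f])
    \<comment> \<open>The fibre \<open>N\<close> of \<open>p\<close> lies in \<open>P t\<close>, so
      N[1] has phase t + 1, above all phases of \<open>Y\<close>; hence \<open>p\<close> can be
      cancelled on the right.\<close>
    then have "f \<odot> j = 0"
      using Tri_cancel_right[OF S(1) cmp_in_Hom[OF hom(2) f]] ph_leD[OF Y_le phases(2) N1] by simp
    then show ?thesis
      using iso_cancel_right[OF j f] by simp
  qed
  then show ?thesis by auto
qed

section \<open>Phase bounds for the twisted objects\<close>

lemma phi_plus_inverse_twist:
  assumes CY: "calabi_yau_2 C" and X: "X \<in> P t" and Y: "\<not> zero_object C Y" "\<not> zero_object C Y'"
    and phases: "phi_minus C P Y = t" "phi_plus C P Y < t + 1"
    and zero: "Hom C X Y = {0}"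
    and coev: "coevaluation C X Y E ev" "Tri C Y' Y E g ev h"
  shows "phi_plus C P Y' \<le> phi_plus C P Y"
proof -
  let ?s = "phi_plus C P Y"
  have Y_le: "Y \<in> ph_le ?s" and Y_ge: "Y \<in> ph_ge t"
    using phi_plus_le_iff[OF Y(1)] phi_minus_ge_iff[OF Y(1)] phases(1) by blast+
  \<comment> \<open>Otherwise the identity of \<open>Y\<close> would vanish.\<close>
  have "t \<le> ?s"
    using Hom_ph_ge_ph_le[OF Y_ge Y_le] idm_in_Hom[of Y] Y(1)
    by (metis not_le singletonD zero_object_iff_idm)
  obtain B \<iota> \<pi> where B: "homogeneous_basis C Y X B" "biproduct C B (\<lambda>(i, f). X\<lbrakk>i\<rbrakk>) E \<iota> \<pi>"
    using coev(1) unfolding coevaluation_def by blast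
  \<comment> \<open>By duality it suffices that Hom^(2-i)(X,Y) vanishes for i \<ge> 2: for i = 2
    this is \<open>zero\<close>, and for i \<ge> 3 the phases of Y[2-i] lie below \<open>t\<close>.
    An upper bound is enough, since smaller degrees give summands X[i] of smaller phase.\<close>
  have degree: "i \<le> 1" if "(i, f) \<in> B" for i f
  proof (rule ccontr)
    assume i: "\<not> i \<le> 1"
    have "gHom C (2 - i) X Y = {0}"
    proof (cases "i = 2")
      case True
      then show ?thesis
        using zero by (simp add: gHom_def sh_0)
    next
      case False
      have "Y\<lbrakk>2 - i\<rbrakk> \<in> ph_le (?s + of_int (2 - i))"
        using Y_le by (rule ph_le_shift) simp
      moreover have "of_int i \<ge> (3::real)"
        using i False by linarith
      ultimately show ?thesis
        using ph_leD[OF _ _ X] phases(2) by (simp add: gHom_def)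
    qed
    then have "gHom C i Y X = {0}"
      by (rule CY_vanishing[OF CY])
    then show False
      using homogeneous_basis_degree[OF B(1) that] by blast
  qed
  have "Y' \<in> ph_le ?s"
  proof (rule ph_leI)
    fix r T
    assume r: "?s < r" and T: "T \<in> P r"
    have T1: "T\<lbrakk>1\<rbrakk> \<in> P (r + 1)"
      using T by (simp add: P_shift1)
    \<comment> \<open>The object T[1] has phase r + 1 > t + 1, while the summands of
      \<open>E\<close> have phase at most t + 1.\<close>
    have "Hom C (T\<lbrakk>1\<rbrakk>) E = {0}"
    proof (rule Hom_biproduct_right[OF B(2)], clarify)
      fix i f assume "(i, f) \<in> B"
      then have "t + of_int i < r + 1"
        using degree r \<open>t \<le> ?s\<close> by fastforce
      then show "Hom C (T\<lbrakk>1\<rbrakk>) (X\<lbrakk>i\<rbrakk>) = {0}"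
        using Hom_P T1 P_shiftI[OF X refl] by blast
    qed
    moreover have "Hom C T Y = {0}"
      using ph_leD[OF Y_le r T] .
    moreover have "w = 0" if "w \<in> Hom C T Y'" "Hom C (T\<lbrakk>1\<rbrakk>) E = {0}" "Hom C T Y = {0}" for w
      using Tri_cancel_left[OF coev(2) that(1)] that(2,3)
        cmp_in_Hom[OF that(1), of g Y] Tri_in_Hom[OF coev(2)] by simp
    ultimately show "Hom C T Y' = {0}"
      by auto
  qed
  then show ?thesis
    by (simp add: phi_plus_le_iff[OF Y(2)])
qed

lemma phi_minus_twist:
  assumes CY: "calabi_yau_2 C" and X: "X \<in> P t" and Y: "\<not> zero_object C Y" "\<not> zero_object C Y'"
    and phases: "phi_plus C P Y = t" "t - 1 < phi_minus C P Y"
    and zero: "Hom C Y X = {0}"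
    and ev: "evaluation C X Y E ev" "Tri C E Y Y' ev g h"
  shows "phi_minus C P Y \<le> phi_minus C P Y'"
proof -
  let ?s = "phi_minus C P Y"
  have Y_le: "Y \<in> ph_le t" and Y_ge: "Y \<in> ph_ge ?s"
    using phi_plus_le_iff[OF Y(1)] phi_minus_ge_iff[OF Y(1)] phases(1) by blast+
  have "?s \<le> t"
    using Hom_ph_ge_ph_le[OF Y_ge Y_le] idm_in_Hom[of Y] Y(1)
    by (metis not_le singletonD zero_object_iff_idm)
  obtain B \<iota> \<pi> where B: "homogeneous_basis C X Y B" "biproduct C B (\<lambda>(i, f). X\<lbrakk>- i\<rbrakk>) E \<iota> \<pi>"
    using ev(1) unfolding evaluation_def by blast
  \<comment> \<open>For i \<ge> 3 the phase t + 2 - i of X[2-i] is at most t - 1, hence below all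
    phases of \<open>Y\<close>; the case i = 2 is \<open>zero\<close>.\<close>
  have degree: "i \<le> 1" if "(i, f) \<in> B" for i f
  proof (rule ccontr)
    assume i: "\<not> i \<le> 1"
    have "gHom C (2 - i) Y X = {0}"
    proof (cases "i = 2")
      case True
      then show ?thesis
        using zero by (simp add: gHom_def sh_0)
    next
      case False
      have "of_int i \<ge> (3::real)"
        using i False by linarith
      then have "t + of_int (2 - i) < ?s"
        using phases(2) by simp
      then show ?thesis
        unfolding gHom_def using ph_geD[OF Y_ge _ P_shiftI[OF X refl]] by blast
    qed
    then have "gHom C i X Y = {0}"
      by (rule CY_vanishing[OF CY])
    then show False
      using homogeneous_basis_degree[OF B(1) that] by blast
  qed
  have "Y' \<in> ph_ge ?s"
  proof (rule ph_geI)
    fix r T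
    assume r: "r < ?s" and T: "T \<in> P r"
    have T1: "T\<lbrakk>- 1\<rbrakk> \<in> P (r - 1)"
      using T by (rule P_shiftI) simp
    \<comment> \<open>The summands X[-i] have phase at least t - 1, and T[-1] has phase r - 1, which
      is smaller.\<close>
    have "Hom C E (T\<lbrakk>- 1\<rbrakk>) = {0}"
    proof (rule Hom_biproduct_left[OF B(2)], clarify)
      fix i f assume "(i, f) \<in> B"
      then have "r - 1 < t + of_int (- i)"
        using degree r \<open>?s \<le> t\<close> by fastforce
      then show "Hom C (X\<lbrakk>- i\<rbrakk>) (T\<lbrakk>- 1\<rbrakk>) = {0}"
        using Hom_P T1 P_shiftI[OF X refl] by blast
    qed
    then have "Hom C (E\<lbrakk>1\<rbrakk>) T = {0}"
      by (simp add: Hom_shift_left)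
    then show "Hom C Y' T = {0}"
      using Hom_extension_left[OF Tri_rotated[OF ev(2)]] ph_geD[OF Y_ge r T] by blast
  qed
  then show ?thesis
    by (simp add: phi_minus_ge_iff[OF Y(2)])
qed

end

theorem proposition3p4:
  fixes C :: "('k::field, 'o, 'm::ab_group_add) tri_cat"
    and P :: "real \<Rightarrow> 'o set" and Z :: "'o \<Rightarrow> complex"
    and X Y :: 'o
    and \<sigma> \<sigma>' :: "'o \<Rightarrow> 'o" and \<sigma>m \<sigma>m' :: "'m \<Rightarrow> 'm"
  assumes "triangulated_category C"
    and "hom_finite C"
    and "calabi_yau_2 C"
    and "stability_condition C P Z"
    and "spherical C X"
    and "spherical_twist C X \<sigma> \<sigma>m \<sigma>' \<sigma>m'"
    and "stable_object C P X"
    and "\<And>X'. \<lbrakk>stable_object C P X'; phase P X' = phase P X\<rbrakk> \<Longrightarrow> isomorphic C X' X"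
    and "\<not> zero_object C Y"
    and "phi_plus C P Y - phi_minus C P Y < 1"
    and "bij_betw (\<lambda>c. smul C c (idm C Y)) UNIV (gHom C 0 Y Y)"
    and "\<not> direct_summand C X Y"
  shows "(phi_minus C P Y = phase P X \<longrightarrow> phi_plus C P Y \<ge> phi_plus C P (\<sigma>' Y)) \<and>
         (phi_plus C P Y = phase P X \<longrightarrow> phi_minus C P Y \<le> phi_minus C P (\<sigma> Y))"
proof -
  interpret category_with_stability C P Z
    using assms(1,4) by (simp add: category_with_stability_def category_with_stability_axioms_def)
  obtain t where t: "simple_in C (P t) X"
    using assms(7) unfolding stable_object_def by blast
  then have X: "X \<in> P t" and phX: "phase P X = t"
    using phase_eq unfolding simple_in_def by blast+
  have unique: "isomorphic C S X" if S: "simple_in C (P t) S" for S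
  proof (rule assms(8))
    show "stable_object C P S"
      using S unfolding stable_object_def by blast
    show "phase P S = phase P X"
      using S phase_eq phX unfolding simple_in_def by blast
  qed
  have End_X: "\<exists>c. a = smul C c (idm C X)" if "a \<in> Hom C X X" for a
    using assms(5) that by (rule spherical_End)
  \<comment> \<open>Surjectivity of the scalar map is the form in which Hom^0(Y,Y) = k
    enters.\<close>
  have End_Y: "\<exists>c. a = smul C c (idm C Y)" if "a \<in> Hom C Y Y" for a
    using assms(11) that unfolding bij_betw_def by (auto simp: gHom_def sh_0)
  have equiv: "mutually_inverse_autoequivalences C \<sigma> \<sigma>m \<sigma>' \<sigma>m'"
    and evs: "\<exists>E ev g h. evaluation C X Y E ev \<and> Tri C E Y (\<sigma> Y) ev g h"
      "\<exists>E g coev h. coevaluation C X Y E coev \<and> Tri C (\<sigma>' Y) Y E g coev h"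
    using assms(6) unfolding spherical_twist_def by blast+
  note nonzero = autoequivalence_nonzero[OF equiv assms(9)]
  have "phi_plus C P (\<sigma>' Y) \<le> phi_plus C P Y" if "phi_minus C P Y = t"
  proof -
    have lt: "phi_plus C P Y < t + 1"
      using assms(10) that by simp
    have "Hom C X Y = {0}"
      by (rule Hom_from_stable_zero[OF X End_X unique assms(9) End_Y that lt assms(12)])
    then show ?thesis
      using phi_plus_inverse_twist[OF assms(3) X assms(9) nonzero(2) that lt] evs(2) by blast
  qed
  moreover have "phi_minus C P Y \<le> phi_minus C P (\<sigma> Y)" if "phi_plus C P Y = t"
  proof -
    have lt: "t - 1 < phi_minus C P Y"
      using assms(10) that by simp
    have "Hom C Y X = {0}"
      by (rule Hom_to_stable_zero[OF X End_X unique assms(9) End_Y that lt assms(12)])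
    then show ?thesis
      using phi_minus_twist[OF assms(3) X assms(9) nonzero(1) that lt] evs(1) by blast
  qed
  ultimately show ?thesis
    using phX by blast
qed

end
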